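(* Let $\mathcal{G}$ be a locally compact group and let $\mathcal{X}$ be a $\mathcal{G}$-space. Then the following assertions hold. (a) $\mathfrak{Z}(\mathcal{X},\mathcal{G})$ is a subalgebra of $LUC(\mathcal{G})^*$. (b) $\mathfrak{Z}(\mathcal{X},\mathcal{G})$ is closed with respect to the norm topology of $LUC(\mathcal{G})^*$. (c) $M(\mathcal{G})$ is contained in $\mathfrak{Z}(\mathcal{X},\mathcal{G})$.
   Context: A (left) $\mathcal{G}$-space is a locally compact Hausdorff space $\mathcal{X}$ with a continuous map $\mathcal{G}\times\mathcal{X}\to\mathcal{X}$, $(s,x)\mapsto s\cdot x$, such that $(st)\cdot x=s\cdot(t\cdot x)$ and $e\cdot x=x$ for all $s,t\in\mathcal{G}$, $x\in\mathcal{X}$, where $e$ is the identity of $\mathcal{G}$. $C_b(\mathcal{X})$ is the space of bounded continuous complex-valued functions on $\mathcal{X}$ with the supremum norm. For $F\in C_b(\mathcal{X})$ and $s\in\mathcal{G}$ put $(l_sF)(x)=F(s\cdot x)$, and let $$LUC(\mathcal{X},\mathcal{G})=\{F\in C_b(\mathcal{X}): s\mapsto l_sF \text{ is continuous from } \mathcal{G} \text{ into } (C_b(\mathcal{X}),\|\cdot\|_\infty)\},$$ a closed subspace of $C_b(\mathcal{X})$ invariant under all $l_s$. $LUC(\mathcal{G})=LUC(\mathcal{G},\mathcal{G})$, with $\mathcal{G}$ acting on itself by left translation; write ${}_sf(t)=f(st)$. $LUC(\mathcal{G})^*$ is a Banach algebra with the product $\langle m\odot n,f\rangle=\langle m,n\diamond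 f\rangle$, where $(n\diamond f)(s)=\langle n,{}_sf\rangle$. $M(\mathcal{G})$, the measure algebra of complex regular Borel measures on $\mathcal{G}$, is viewed as a subalgebra of $LUC(\mathcal{G})^*$ via $\langle\mu,f\rangle=\int_{\mathcal{G}}f\,d\mu$. For $M\in LUC(\mathcal{X},\mathcal{G})^*$ and $F\in LUC(\mathcal{X},\mathcal{G})$, the function $MF\in LUC(\mathcal{G})$ is given by $(MF)(s)=\langle M,l_sF\rangle$. For $m\in LUC(\mathcal{G})^*$, the functional $m\cdot M\in LUC(\mathcal{X},\mathcal{G})^*$ is given by $\langle m\cdot M,F\rangle=\langle m,MF\rangle$. Define $$\mathfrak{Z}(\mathcal{X},\mathcal{G})=\{m\in LUC(\mathcal{G})^*: M\mapsto m\cdot M \text{ is weak}^*\text{ to weak}^*\text{ continuous on } LUC(\mathcal{X},\mathcal{G})^*\}.$$ *)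

theory Defs
  imports "HOL-Analysis.Analysis"
begin

text \<open>
  Groups are types of class \<^class>\<open>topological_group_add\<close> (and \<^class>\<open>t2_space\<close>). This class
  does not assume commutativity; the group law \<open>st\<close> is written \<open>s + t\<close> and the identity \<open>e\<close>
  is \<open>0\<close>. \<open>C\<^sub>b(X)\<close> is the library type of bounded continuous functions into \<^typ>\<open>complex\<close>
  with its supremum norm.
\<close>

definition g_space :: "('g::topological_group_add \<Rightarrow> 'x::t2_space \<Rightarrow> 'x) \<Rightarrow> bool" where
  "g_space act \<longleftrightarrow>
     locally_compact_space (euclidean :: 'x topology) \<and>
     continuous_on UNIV (\<lambda>(s, x). act s x) \<and>
     (\<forall>s t x. act (s + t) x = act s (act t x)) \<and>
     (\<forall>x. act 0 x = x)"

text \<open>The \<^const>\<open>Bcontfun\<close> in the next definition is meaningful when \<open>act s\<close> is continuous,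
  in particular for every \<open>g_space\<close> (see \<open>apply_ltranslate\<close> below; \<open>apply_cscale\<close> and
  \<open>apply_orbit_fun\<close> do the same for the later uses of \<^const>\<open>Bcontfun\<close>).\<close>

definition ltranslate ::
  "('g \<Rightarrow> 'x \<Rightarrow> 'x) \<Rightarrow> 'g \<Rightarrow> ('x::topological_space \<Rightarrow>\<^sub>C complex) \<Rightarrow> ('x \<Rightarrow>\<^sub>C complex)" where
  "ltranslate act s F = Bcontfun (\<lambda>x. F (act s x))"

definition LUC ::
  "('g::topological_space \<Rightarrow> 'x \<Rightarrow> 'x) \<Rightarrow> ('x::topological_space \<Rightarrow>\<^sub>C complex) set" where
  "LUC act = {F. continuous_on UNIV (\<lambda>s. ltranslate act s F)}"

abbreviation LUCG :: "('g::topological_group_add \<Rightarrow>\<^sub>C complex) set" where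
  "LUCG \<equiv> LUC (+)"

definition cscale ::
  "complex \<Rightarrow> ('x::topological_space \<Rightarrow>\<^sub>C complex) \<Rightarrow> ('x \<Rightarrow>\<^sub>C complex)" where
  "cscale c F = Bcontfun (\<lambda>x. c * F x)"

text \<open>
  The dual of a complex subspace \<open>S\<close> of \<open>C\<^sub>b(X)\<close>: bounded complex linear functionals on \<open>S\<close>. They
  are required to be extensional (\<^const>\<open>undefined\<close> outside \<open>S\<close>), so that functionals on \<open>S\<close>
  are equal precisely when they agree on \<open>S\<close>.
\<close>

definition dual_space ::
  "('x::topological_space \<Rightarrow>\<^sub>C complex) set \<Rightarrow> (('x \<Rightarrow>\<^sub>C complex) \<Rightarrow> complex) set" where
  "dual_space S = {m \<in> extensional S.
     (\<forall>F\<in>S. \<forall>G\<in>S. m (F + G) = m F + m G) \<and>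
     (\<forall>c. \<forall>F\<in>S. m (cscale c F) = c * m F) \<and>
     (\<exists>C. \<forall>F\<in>S. cmod (m F) \<le> C * norm F)}"

definition dual_norm ::
  "('x::topological_space \<Rightarrow>\<^sub>C complex) set \<Rightarrow> (('x \<Rightarrow>\<^sub>C complex) \<Rightarrow> complex) \<Rightarrow> real" where
  "dual_norm S m = (SUP F\<in>{F \<in> S. norm F \<le> 1}. cmod (m F))"

text \<open>The distance of two functionals is the norm of their difference; it is set to \<open>0\<close> off
  the dual only because \<^const>\<open>Metric_space\<close> constrains it there too (see
  \<open>Metric_space_dual\<close> below).\<close>

definition dual_dist ::
  "('x::topological_space \<Rightarrow>\<^sub>C complex) set \<Rightarrow> (('x \<Rightarrow>\<^sub>C complex) \<Rightarrow> complex) \<Rightarrow>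
   (('x \<Rightarrow>\<^sub>C complex) \<Rightarrow> complex) \<Rightarrow> real" where
  "dual_dist S m n =
     (if m \<in> dual_space S \<and> n \<in> dual_space S then dual_norm S (\<lambda>F\<in>S. m F - n F) else 0)"

definition norm_topology ::
  "('x::topological_space \<Rightarrow>\<^sub>C complex) set \<Rightarrow> (('x \<Rightarrow>\<^sub>C complex) \<Rightarrow> complex) topology" where
  "norm_topology S = Metric_space.mtopology (dual_space S) (dual_dist S)"

text \<open>The weak* topology is the topology of pointwise convergence on \<open>S\<close>.\<close>

definition weak_star ::
  "('x::topological_space \<Rightarrow>\<^sub>C complex) set \<Rightarrow> (('x \<Rightarrow>\<^sub>C complex) \<Rightarrow> complex) topology" where
  "weak_star S = subtopology (product_topology (\<lambda>_. euclidean) S) (dual_space S)"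

text \<open>\<open>arens m n\<close> is the product \<open>m \<odot> n\<close> of \<open>LUC(G)*\<close>. Note that \<open>ltranslate (+) s f\<close> is
  the function \<open>t \<mapsto> f (s + t)\<close>.\<close>

definition diamond ::
  "(('g::topological_group_add \<Rightarrow>\<^sub>C complex) \<Rightarrow> complex) \<Rightarrow> ('g \<Rightarrow>\<^sub>C complex) \<Rightarrow> ('g \<Rightarrow>\<^sub>C complex)" where
  "diamond n f = Bcontfun (\<lambda>s. n (ltranslate (+) s f))"

definition arens ::
  "(('g::topological_group_add \<Rightarrow>\<^sub>C complex) \<Rightarrow> complex) \<Rightarrow> (('g \<Rightarrow>\<^sub>C complex) \<Rightarrow> complex) \<Rightarrow>
   (('g \<Rightarrow>\<^sub>C complex) \<Rightarrow> complex)" where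
  "arens m n = (\<lambda>f\<in>LUCG. m (diamond n f))"

text \<open>\<open>orbit_fun act M F\<close> is the function \<open>MF\<close> on the group and \<open>module_act act m M\<close> is the
  functional \<open>m \<cdot> M\<close>.\<close>

definition orbit_fun ::
  "('g::topological_group_add \<Rightarrow> 'x \<Rightarrow> 'x) \<Rightarrow> (('x::topological_space \<Rightarrow>\<^sub>C complex) \<Rightarrow> complex) \<Rightarrow>
   ('x \<Rightarrow>\<^sub>C complex) \<Rightarrow> ('g \<Rightarrow>\<^sub>C complex)" where
  "orbit_fun act M F = Bcontfun (\<lambda>s. M (ltranslate act s F))"

definition module_act ::
  "('g::topological_group_add \<Rightarrow> 'x \<Rightarrow> 'x) \<Rightarrow> (('g \<Rightarrow>\<^sub>C complex) \<Rightarrow> complex) \<Rightarrow>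
   (('x::topological_space \<Rightarrow>\<^sub>C complex) \<Rightarrow> complex) \<Rightarrow> (('x \<Rightarrow>\<^sub>C complex) \<Rightarrow> complex)" where
  "module_act act m M = (\<lambda>F\<in>LUC act. m (orbit_fun act M F))"

definition top_centre ::
  "('g::topological_group_add \<Rightarrow> 'x \<Rightarrow> 'x::topological_space) \<Rightarrow>
   (('g \<Rightarrow>\<^sub>C complex) \<Rightarrow> complex) set" where
  "top_centre act = {m \<in> dual_space LUCG.
     continuous_map (weak_star (LUC act)) (weak_star (LUC act)) (module_act act m)}"

definition is_subalgebra :: "(('g::topological_group_add \<Rightarrow>\<^sub>C complex) \<Rightarrow> complex) set \<Rightarrow> bool" where
  "is_subalgebra A \<longleftrightarrow>
     A \<subseteq> dual_space LUCG \<and>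
     (\<lambda>f\<in>LUCG. 0) \<in> A \<and>
     (\<forall>m\<in>A. \<forall>n\<in>A. (\<lambda>f\<in>LUCG. m f + n f) \<in> A) \<and>
     (\<forall>c. \<forall>m\<in>A. (\<lambda>f\<in>LUCG. c * m f) \<in> A) \<and>
     (\<forall>m\<in>A. \<forall>n\<in>A. arens m n \<in> A)"

text \<open>
  Complex Borel measures are countably additive set functions on the Borel sets (their values on
  other sets are irrelevant). As usual, such a measure is regular if its total variation is both
  outer regular and inner regular with respect to compact sets.
\<close>

definition complex_measure :: "('g::topological_space set \<Rightarrow> complex) \<Rightarrow> bool" where
  "complex_measure \<mu> \<longleftrightarrow>
     (\<forall>A :: nat \<Rightarrow> 'g set. range A \<subseteq> sets borel \<longrightarrow> disjoint_family A \<longrightarrow>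
        (\<lambda>n. \<mu> (A n)) sums \<mu> (\<Union>n. A n))"

definition total_variation ::
  "('g::topological_space set \<Rightarrow> complex) \<Rightarrow> 'g set \<Rightarrow> ennreal" where
  "total_variation \<mu> E =
     (SUP A\<in>{A :: nat \<Rightarrow> 'g set. range A \<subseteq> sets borel \<and> disjoint_family A \<and> (\<Union>n. A n) = E}.
        (\<Sum>n. ennreal (cmod (\<mu> (A n)))))"

definition regular_measure :: "('g::topological_space set \<Rightarrow> complex) \<Rightarrow> bool" where
  "regular_measure \<mu> \<longleftrightarrow>
     (\<forall>E\<in>sets borel.
        total_variation \<mu> E = (INF U\<in>{U. open U \<and> E \<subseteq> U}. total_variation \<mu> U) \<and>
        total_variation \<mu> E = (SUP K\<in>{K. compact K \<and> K \<subseteq> E}. total_variation \<mu> K))"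

text \<open>
  Integration against a complex measure uses the Jordan decompositions of its real and imaginary
  parts. The positive variation of a real measure \<open>\<nu>\<close> is \<open>E \<mapsto> sup {\<nu> B | B \<subseteq> E Borel}\<close>, its
  negative variation is the positive variation of \<open>-\<nu>\<close>. The coercion \<^const>\<open>ennreal\<close> truncates
  negative values to \<open>0\<close>, which does not affect the supremum since \<open>\<nu> {} = 0\<close>.
\<close>

definition positive_variation ::
  "('g::topological_space set \<Rightarrow> real) \<Rightarrow> 'g measure" where
  "positive_variation \<nu> =
     measure_of UNIV (sets borel) (\<lambda>E. SUP B\<in>{B \<in> sets borel. B \<subseteq> E}. ennreal (\<nu> B))"

definition complex_integral ::
  "('g::topological_space set \<Rightarrow> complex) \<Rightarrow> ('g \<Rightarrow> complex) \<Rightarrow> complex" where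
  "complex_integral \<mu> f =
     (integral\<^sup>L (positive_variation (\<lambda>E. Re (\<mu> E))) f
       - integral\<^sup>L (positive_variation (\<lambda>E. - Re (\<mu> E))) f)
     + \<i> * (integral\<^sup>L (positive_variation (\<lambda>E. Im (\<mu> E))) f
       - integral\<^sup>L (positive_variation (\<lambda>E. - Im (\<mu> E))) f)"

definition measure_algebra :: "(('g::topological_group_add \<Rightarrow>\<^sub>C complex) \<Rightarrow> complex) set" where
  "measure_algebra =
     {(\<lambda>f\<in>LUCG. complex_integral \<mu> (apply_bcontfun f)) | \<mu>. complex_measure \<mu> \<and> regular_measure \<mu>}"

lemma apply_cscale: "apply_bcontfun (cscale c F) x = c * F x"
proof -
  have "bounded ((\<lambda>z. c * z) ` range (apply_bcontfun F))"
    using bounded_apply_bcontfun[of F]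
    by (intro bounded_linear_image bounded_linear_mult_right)
  moreover have "continuous_on UNIV (\<lambda>x. c * F x)"
    by (intro continuous_intros) auto
  ultimately have "(\<lambda>x. c * F x) \<in> bcontfun"
    by (auto simp: bcontfun_def image_image)
  then show ?thesis
    by (simp add: cscale_def Bcontfun_inverse)
qed

lemma apply_ltranslate:
  assumes "g_space act"
  shows "apply_bcontfun (ltranslate act s F) x = F (act s x)"
proof -
  have "continuous_on UNIV (\<lambda>p. case p of (s, x) \<Rightarrow> act s x)"
    using assms by (simp add: g_space_def)
  from continuous_on_compose2[OF this, of UNIV "\<lambda>x. (s, x)"]
  have "continuous_on UNIV (\<lambda>x. act s x)"
    by (simp add: continuous_on_Pair)
  from continuous_on_compose2[OF continuous_on_apply_bcontfun[of UNIV F] this]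
  have "continuous_on UNIV (\<lambda>x. F (act s x))"
    by simp
  moreover have "bounded (range (\<lambda>x. F (act s x)))"
    by (rule bounded_subset[OF bounded_apply_bcontfun[of F]]) auto
  ultimately have "(\<lambda>x. F (act s x)) \<in> bcontfun"
    by (simp add: bcontfun_def)
  then show ?thesis
    by (simp add: ltranslate_def Bcontfun_inverse)
qed

lemma g_space_self:
  assumes "locally_compact_space (euclidean :: 'g::{topological_group_add, t2_space} topology)"
  shows "g_space ((+) :: 'g \<Rightarrow> 'g \<Rightarrow> 'g)"
  using assms unfolding g_space_def
  by (auto simp: add.assoc case_prod_unfold intro!: continuous_intros)

lemma norm_ltranslate_le:
  assumes "g_space act"
  shows "norm (ltranslate act s F) \<le> norm F"
  by (rule norm_bound) (simp add: apply_ltranslate[OF assms] norm_bounded)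

lemma ltranslate_in_LUC:
  assumes "g_space act" and "F \<in> LUC act"
  shows "ltranslate act s F \<in> LUC act"
proof -
  have "ltranslate act t (ltranslate act s F) = ltranslate act (s + t) F" for t
    using assms(1) by (intro bcontfun_eqI) (simp add: apply_ltranslate g_space_def)
  moreover have "continuous_on UNIV (\<lambda>t. ltranslate act (s + t) F)"
    using assms(2) continuous_on_compose2[of UNIV "\<lambda>t. ltranslate act t F" UNIV "\<lambda>t. s + t"]
    by (simp add: LUC_def continuous_on_add)
  ultimately show ?thesis
    by (simp add: LUC_def)
qed

lemma cscale_in_LUC:
  fixes act :: "'g::topological_group_add \<Rightarrow> 'x::t2_space \<Rightarrow> 'x"
  assumes "g_space act" and "F \<in> LUC act"
  shows "cscale c F \<in> LUC act"
proof -
  have eq: "ltranslate act s (cscale c F) = cscale c (ltranslate act s F)" for s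
    by (intro bcontfun_eqI) (simp add: apply_ltranslate[OF assms(1)] apply_cscale)
  have "norm (cscale c H - cscale c K) \<le> cmod c * norm (H - K)"
    for H K :: "'x \<Rightarrow>\<^sub>C complex"
  proof (rule norm_bound)
    fix x
    have "norm (apply_bcontfun (cscale c H - cscale c K) x)
        = cmod c * norm (apply_bcontfun (H - K) x)"
      by (simp add: apply_cscale flip: norm_mult right_diff_distrib)
    then show "norm (apply_bcontfun (cscale c H - cscale c K) x) \<le> cmod c * norm (H - K)"
      using mult_left_mono[OF norm_bounded[of "H - K" x], of "cmod c"] by simp
  qed
  then have "(cmod c)-lipschitz_on UNIV (cscale c :: ('x \<Rightarrow>\<^sub>C complex) \<Rightarrow> _)"
    by (intro lipschitz_onI) (auto simp: dist_norm)
  then have "continuous_on UNIV (cscale c :: ('x \<Rightarrow>\<^sub>C complex) \<Rightarrow> _)"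
    by (rule lipschitz_on_continuous_on)
  from continuous_on_compose2[OF this] assms(2) show ?thesis
    by (simp add: LUC_def eq)
qed

lemma add_in_LUC:
  assumes "g_space act" and "F \<in> LUC act" and "G \<in> LUC act"
  shows "F + G \<in> LUC act"
proof -
  have "ltranslate act s (F + G) = ltranslate act s F + ltranslate act s G" for s
    by (intro bcontfun_eqI) (simp add: apply_ltranslate[OF assms(1)])
  then show ?thesis
    using assms(2,3) by (simp add: LUC_def continuous_on_add)
qed

lemma apply_orbit_fun:
  assumes "g_space act" and "M \<in> dual_space (LUC act)" and "F \<in> LUC act"
  shows "apply_bcontfun (orbit_fun act M F) s = M (ltranslate act s F)"
proof -
  obtain C where C: "\<And>H. H \<in> LUC act \<Longrightarrow> cmod (M H) \<le> C * norm H"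
    using assms(2) unfolding dual_space_def by blast
  have diff: "H - K \<in> LUC act \<and> M (H - K) = M H - M K"
    if "H \<in> LUC act" "K \<in> LUC act" for H K
  proof -
    have "H - K = H + cscale (- 1) K"
      by (intro bcontfun_eqI) (simp add: apply_cscale)
    moreover have "M (H + cscale (- 1) K) = M H + - 1 * M K"
      using assms(2) that cscale_in_LUC[OF assms(1) that(2), of "- 1"]
      unfolding dual_space_def by auto
    ultimately show ?thesis
      using add_in_LUC[OF assms(1) that(1) cscale_in_LUC[OF assms(1) that(2)], of "- 1"]
      by (simp only:) simp
  qed
  have bound: "cmod (M H) \<le> \<bar>C\<bar> * norm H" if "H \<in> LUC act" for H
    using C[OF that] by (meson abs_ge_self mult_right_mono norm_ge_zero order_trans)
  have "\<bar>C\<bar>-lipschitz_on (LUC act) M"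
  proof (rule lipschitz_onI)
    fix H K
    assume HK: "H \<in> LUC act" "K \<in> LUC act"
    then have "cmod (M H - M K) = cmod (M (H - K))"
      using diff[OF HK] by simp
    then show "dist (M H) (M K) \<le> \<bar>C\<bar> * dist H K"
      using bound[of "H - K"] diff[OF HK] by (simp add: dist_norm)
  qed simp
  then have "continuous_on (LUC act) M"
    by (rule lipschitz_on_continuous_on)
  then have "continuous_on UNIV (\<lambda>s. M (ltranslate act s F))"
    by (rule continuous_on_compose2)
      (use assms in \<open>auto simp: ltranslate_in_LUC\<close>, simp add: LUC_def)
  moreover have "cmod (M (ltranslate act s F)) \<le> \<bar>C\<bar> * norm F" for s
    using bound[OF ltranslate_in_LUC[OF assms(1,3)], of s]
      mult_left_mono[OF norm_ltranslate_le[OF assms(1), of s F], of "\<bar>C\<bar>"] by linarith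
  then have "bounded (range (\<lambda>s. M (ltranslate act s F)))"
    by (auto simp: bounded_iff)
  ultimately show ?thesis
    by (simp add: orbit_fun_def Bcontfun_inverse bcontfun_def)
qed

lemma Metric_space_dual:
  fixes act :: "'g::topological_group_add \<Rightarrow> 'x::t2_space \<Rightarrow> 'x"
  assumes "g_space act"
  shows "Metric_space (dual_space (LUC act)) (dual_dist (LUC act))"
proof -
  define S where "S = LUC act"
  define B where "B = {F \<in> S. norm F \<le> 1}"
  have "ltranslate act s 0 = 0" for s
    by (intro bcontfun_eqI) (simp add: apply_ltranslate[OF assms])
  then have "0 \<in> B"
    by (simp add: B_def S_def LUC_def)
  have norm_eq: "dual_norm S (\<lambda>F\<in>S. m F - n F) = (SUP F\<in>B. cmod (m F - n F))" for m n
    unfolding dual_norm_def B_def by (intro SUP_cong) auto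
  have bdd: "bdd_above ((\<lambda>F. cmod (m F - n F)) ` B)"
    if mn: "m \<in> dual_space S" "n \<in> dual_space S" for m n
  proof -
    obtain C D where CD: "\<forall>F\<in>S. cmod (m F) \<le> C * norm F" "\<forall>F\<in>S. cmod (n F) \<le> D * norm F"
      using mn unfolding dual_space_def by blast
    have "cmod (m F - n F) \<le> \<bar>C\<bar> + \<bar>D\<bar>" if "F \<in> B" for F
    proof -
      have F: "F \<in> S" "norm F \<le> 1"
        using that by (auto simp: B_def)
      have "c * norm F \<le> \<bar>c\<bar>" for c
        using mult_mono[OF abs_ge_self[of c] F(2)] by simp
      then show ?thesis
        using CD F(1) norm_triangle_ineq4[of "m F" "n F"] by (smt (verit, best))
    qed
    then show ?thesis
      by (intro bdd_aboveI2)
  qed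
  have le: "cmod (m F - n F) \<le> dual_dist S m n"
    if "m \<in> dual_space S" "n \<in> dual_space S" "F \<in> B" for m n F
    using that unfolding dual_dist_def norm_eq by (auto intro: cSUP_upper bdd)
  have "Metric_space (dual_space S) (dual_dist S)"
  proof
    fix m n
    show "0 \<le> dual_dist S m n"
      using order_trans[OF norm_ge_zero le[of m n 0]] \<open>0 \<in> B\<close>
      by (cases "m \<in> dual_space S \<and> n \<in> dual_space S") (auto simp: dual_dist_def)
    show "dual_dist S m n = dual_dist S n m"
      unfolding dual_dist_def norm_eq by (simp add: norm_minus_commute conj_commute)
  next
    fix m n
    assume mn: "m \<in> dual_space S" "n \<in> dual_space S"
    show "dual_dist S m n = 0 \<longleftrightarrow> m = n"
    proof
      assume d: "dual_dist S m n = 0"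
      have "m F = n F" if F: "F \<in> S" for F
      proof -
        define r where "r = inverse (norm F + 1)"
        define c where "c = complex_of_real r"
        have pos: "0 < norm F + 1"
          using norm_ge_zero[of F] by linarith
        then have r: "0 < r" "r * (norm F + 1) = 1"
          by (auto simp: r_def)
        then have "c \<noteq> 0"
          by (simp add: c_def)
        have "norm (cscale c F) \<le> 1"
        proof (rule norm_bound)
          fix x
          have "cmod (apply_bcontfun F x) \<le> norm F + 1"
            using norm_bounded[of F x] by simp
          then have "r * cmod (apply_bcontfun F x) \<le> r * (norm F + 1)"
            using r(1) by (intro mult_left_mono) auto
          then show "norm (apply_bcontfun (cscale c F) x) \<le> 1"
            using r by (simp add: apply_cscale c_def norm_mult)
        qed
        then have "cscale c F \<in> B"
          using F cscale_in_LUC[OF assms] by (simp add: B_def S_def)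
        from le[OF mn this] have "m (cscale c F) = n (cscale c F)"
          by (simp add: d)
        then have "c * m F = c * n F"
          using mn F unfolding dual_space_def by auto
        then show ?thesis
          using \<open>c \<noteq> 0\<close> by simp
      qed
      then show "m = n"
        using mn unfolding dual_space_def by (auto intro: extensionalityI)
    next
      assume "m = n"
      then have "dual_dist S m n = (SUP F\<in>B. cmod (m F - n F))"
        using mn by (simp only: dual_dist_def norm_eq simp_thms if_True)
      also have "\<dots> = (SUP F\<in>B. 0)"
        using \<open>m = n\<close> by simp
      also have "\<dots> = 0"
        using \<open>0 \<in> B\<close> by (intro cSUP_const) auto
      finally show "dual_dist S m n = 0" .
    qed
  next
    fix l m n
    assume lmn: "l \<in> dual_space S" "m \<in> dual_space S" "n \<in> dual_space S"
    have "cmod (l F - n F) \<le> dual_dist S l m + dual_dist S m n" if "F \<in> B" for F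
      using le[OF lmn(1,2) that] le[OF lmn(2,3) that]
        norm_triangle_ineq[of "l F - m F" "m F - n F"] by simp
    then have "(SUP F\<in>B. cmod (l F - n F)) \<le> dual_dist S l m + dual_dist S m n"
      using \<open>0 \<in> B\<close> by (intro cSUP_least) auto
    then show "dual_dist S l n \<le> dual_dist S l m + dual_dist S m n"
      using lmn by (simp add: dual_dist_def norm_eq)
  qed
  then show ?thesis
    by (simp add: S_def)
qed

end

theory Submission
  imports Defs
begin

text \<open>
  A weak* continuous linear functional on \<open>LUC(X,G)*\<close> is evaluation at a function, so \<open>m\<close> lies in
  the topological centre iff every \<open>F\<close> has a companion \<open>H\<close> with \<open>\<langle>m, MF\<rangle> = \<langle>M, H\<rangle>\<close> for all \<open>M\<close>; in
  this form (a) is immediate from \<open>(n \<cdot> M)F = n \<diamond> (MF)\<close>. It even suffices that \<open>\<langle>m, MF\<rangle>\<close> is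
  approximated by functionals \<open>\<langle>M, R\<rangle>\<close> with error \<open>\<epsilon> \<parallel>M\<parallel>\<close>: testing against point evaluations, the
  functions \<open>R\<close> converge uniformly to such an \<open>H\<close>. For a norm limit \<open>m\<close> of elements of the centre the
  approximants are the companions of these elements; for a regular measure they are Riemann sums of
  \<open>s \<mapsto> l\<^sub>s F\<close> over a compact set carrying all but little of the variation.
\<close>

section \<open>The modules \<open>LUC\<close> and their duals\<close>

lemma dual_space_extensional: "m \<in> dual_space S \<Longrightarrow> m \<in> extensional S"
  by (simp add: dual_space_def)

lemma dual_space_add: "m \<in> dual_space S \<Longrightarrow> F \<in> S \<Longrightarrow> G \<in> S \<Longrightarrow> m (F + G) = m F + m G"
  by (simp add: dual_space_def)

lemma dual_space_cscale: "m \<in> dual_space S \<Longrightarrow> F \<in> S \<Longrightarrow> m (cscale c F) = c * m F"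
  by (simp add: dual_space_def)

lemma dual_space_boundE:
  assumes "m \<in> dual_space S"
  obtains C where "0 \<le> C" "\<And>F. F \<in> S \<Longrightarrow> cmod (m F) \<le> C * norm F"
proof -
  obtain C where C: "\<forall>F\<in>S. cmod (m F) \<le> C * norm F"
    using assms by (auto simp: dual_space_def)
  have "cmod (m F) \<le> \<bar>C\<bar> * norm F" if "F \<in> S" for F
    using C that by (meson abs_ge_self mult_right_mono norm_ge_zero order_trans)
  then show thesis
    using that[of "\<bar>C\<bar>"] by simp
qed

lemma dual_spaceI:
  assumes "m \<in> extensional S"
    and "\<And>F G. F \<in> S \<Longrightarrow> G \<in> S \<Longrightarrow> m (F + G) = m F + m G"
    and "\<And>c F. F \<in> S \<Longrightarrow> m (cscale c F) = c * m F"
    and "\<And>F. F \<in> S \<Longrightarrow> cmod (m F) \<le> C * norm F"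
  shows "m \<in> dual_space S"
  using assms unfolding dual_space_def by blast

lemma norm_cscale: "norm (cscale c F) \<le> cmod c * norm F"
  by (rule norm_bound) (simp add: apply_cscale norm_mult mult_left_mono norm_bounded)

lemma zero_in_LUC:
  assumes "g_space act"
  shows "0 \<in> LUC act"
proof -
  have "ltranslate act s 0 = 0" for s
    by (intro bcontfun_eqI) (simp add: apply_ltranslate[OF assms])
  then show ?thesis
    by (simp add: LUC_def)
qed

lemma diff_eq_add_cscale: "F - G = F + cscale (- 1) G"
  by (intro bcontfun_eqI) (simp add: apply_cscale)

lemma diff_in_LUC:
  assumes "g_space act" "F \<in> LUC act" "G \<in> LUC act"
  shows "F - G \<in> LUC act"
  unfolding diff_eq_add_cscale using assms by (intro add_in_LUC cscale_in_LUC)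

lemma dual_space_diff:
  assumes "g_space act" "m \<in> dual_space (LUC act)" "F \<in> LUC act" "G \<in> LUC act"
  shows "m (F - G) = m F - m G"
  unfolding diff_eq_add_cscale
  using assms by (simp add: dual_space_add cscale_in_LUC dual_space_cscale)

lemma dual_space_zero:
  assumes "g_space act" "m \<in> dual_space (LUC act)"
  shows "m 0 = 0"
  using dual_space_diff[OF assms, of 0 0] zero_in_LUC[OF assms(1)] by simp

text \<open>Turns a finite combination of evaluations into evaluation at a single function. Both
  claims share one induction because additivity of \<open>m\<close> applies only once the partial
  sum is known to lie in \<open>LUC act\<close>.\<close>

lemma LUC_sum:
  assumes "g_space act" "finite I" "I \<subseteq> LUC act"
  shows "(\<Sum>F\<in>I. cscale (c F) F) \<in> LUC act"
    and "m \<in> dual_space (LUC act) \<Longrightarrow> m (\<Sum>F\<in>I. cscale (c F) F) = (\<Sum>F\<in>I. c F * m F)"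
proof -
  have "(\<Sum>F\<in>I. cscale (c F) F) \<in> LUC act \<and>
    (m \<in> dual_space (LUC act) \<longrightarrow> m (\<Sum>F\<in>I. cscale (c F) F) = (\<Sum>F\<in>I. c F * m F))"
    using assms(2,3)
  proof (induction I)
    case empty
    then show ?case
      using zero_in_LUC dual_space_zero assms(1) by auto
  next
    case (insert F I)
    then show ?case
      using assms(1) by (auto simp: add_in_LUC cscale_in_LUC dual_space_add dual_space_cscale)
  qed
  then show "(\<Sum>F\<in>I. cscale (c F) F) \<in> LUC act"
    and "m \<in> dual_space (LUC act) \<Longrightarrow> m (\<Sum>F\<in>I. cscale (c F) F) = (\<Sum>F\<in>I. c F * m F)"
    by auto
qed

text \<open>The last equation reverses the order: \<open>ltranslate act t\<close> feeds
  \<open>act t x\<close> into its argument, so translations compose as an anti-homomorphism.\<close>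

lemma ltranslate_linear:
  assumes "g_space act"
  shows "ltranslate act s (F + G) = ltranslate act s F + ltranslate act s G"
    and "ltranslate act s (F - G) = ltranslate act s F - ltranslate act s G"
    and "ltranslate act s (cscale c F) = cscale c (ltranslate act s F)"
    and "ltranslate act t (ltranslate act s F) = ltranslate act (s + t) F"
proof -
  have "act (s + t) x = act s (act t x)" for x
    using assms by (simp add: g_space_def)
  then show "ltranslate act t (ltranslate act s F) = ltranslate act (s + t) F"
    by (intro bcontfun_eqI) (simp add: apply_ltranslate[OF assms])
qed (auto intro!: bcontfun_eqI simp: apply_ltranslate[OF assms] apply_cscale)

text \<open>Each \<open>ltranslate act s\<close> is a contraction, so norm convergence of
  \<open>R n\<close> makes the orbit maps converge uniformly in \<open>s\<close>, and a uniform
  limit of continuous maps is continuous.\<close>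

lemma closed_LUC:
  assumes "g_space act"
  shows "closed (LUC act)"
  unfolding closed_sequential_limits
proof (intro allI impI)
  fix R F
  assume R: "(\<forall>n. R n \<in> LUC act) \<and> R \<longlonglongrightarrow> F"
  have "uniform_limit UNIV (\<lambda>n s. ltranslate act s (R n)) (\<lambda>s. ltranslate act s F) sequentially"
  proof (rule uniform_limitI)
    fix e :: real assume "0 < e"
    then have "\<forall>\<^sub>F n in sequentially. dist (R n) F < e"
      using R tendstoD by blast
    then show "\<forall>\<^sub>F n in sequentially. \<forall>s\<in>UNIV. dist (ltranslate act s (R n)) (ltranslate act s F) < e"
    proof eventually_elim
      case (elim n)
      have "norm (ltranslate act s (R n) - ltranslate act s F) \<le> norm (R n - F)" for s
        using norm_ltranslate_le[OF assms, of s "R n - F"] by (simp add: ltranslate_linear[OF assms])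
      with elim show ?case
        unfolding dist_norm by (blast intro: le_less_trans)
    qed
  qed
  moreover have "\<forall>\<^sub>F n in sequentially. continuous_on UNIV (\<lambda>s. ltranslate act s (R n))"
    using R by (simp add: LUC_def)
  ultimately show "F \<in> LUC act"
    unfolding LUC_def by (auto intro: uniform_limit_theorem[rotated])
qed

text \<open>The norm of \<open>M\<close> enters through an arbitrary admissible constant
  \<open>C\<close>, the form in which \<open>dual_space_boundE\<close> supplies it.\<close>

lemma norm_orbit_fun_le:
  assumes "g_space act" "M \<in> dual_space (LUC act)" "F \<in> LUC act" "0 \<le> C"
    and "\<And>F. F \<in> LUC act \<Longrightarrow> cmod (M F) \<le> C * norm F"
  shows "norm (orbit_fun act M F) \<le> C * norm F"
proof (rule norm_bound)
  fix s
  show "norm (apply_bcontfun (orbit_fun act M F) s) \<le> C * norm F"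
    using assms(5)[OF ltranslate_in_LUC[OF assms(1,3)], of s]
      mult_left_mono[OF norm_ltranslate_le[OF assms(1), of s F] assms(4)]
    by (simp add: apply_orbit_fun assms)
qed

lemma orbit_fun_linear:
  assumes A: "g_space act" and M: "M \<in> dual_space (LUC act)" and F: "F \<in> LUC act"
  shows "G \<in> LUC act \<Longrightarrow> orbit_fun act M (F + G) = orbit_fun act M F + orbit_fun act M G"
    and "G \<in> LUC act \<Longrightarrow> orbit_fun act M (F - G) = orbit_fun act M F - orbit_fun act M G"
    and "orbit_fun act M (cscale c F) = cscale c (orbit_fun act M F)"
  by (auto intro!: bcontfun_eqI simp: apply_orbit_fun[OF A M] F apply_cscale add_in_LUC[OF A]
    diff_in_LUC[OF A] cscale_in_LUC[OF A] ltranslate_linear(1-3)[OF A] dual_space_add[OF M]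
    dual_space_diff[OF A M] dual_space_cscale[OF M] ltranslate_in_LUC[OF A])

lemma ltranslate_orbit_fun:
  fixes act :: "'g::{topological_group_add, t2_space} \<Rightarrow> 'x::t2_space \<Rightarrow> 'x"
  assumes lc: "locally_compact_space (euclidean :: 'g topology)"
    and A: "g_space act" and M: "M \<in> dual_space (LUC act)" and F: "F \<in> LUC act"
  shows "ltranslate (+) s (orbit_fun act M F) = orbit_fun act M (ltranslate act s F)"
  by (rule bcontfun_eqI)
    (simp add: apply_orbit_fun[OF A M] apply_ltranslate[OF g_space_self[OF lc]]
      ltranslate_linear(4)[OF A] ltranslate_in_LUC[OF A] F)

text \<open>By \<open>ltranslate_orbit_fun\<close> the orbit of \<open>MF\<close> is the image of
  the orbit of \<open>F\<close> under \<open>orbit_fun act M\<close>, which is Lipschitz by the norm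
  estimate; hence it is continuous.\<close>

lemma orbit_fun_in_LUC:
  fixes act :: "'g::{topological_group_add, t2_space} \<Rightarrow> 'x::t2_space \<Rightarrow> 'x"
  assumes "locally_compact_space (euclidean :: 'g topology)"
    and "g_space act" "M \<in> dual_space (LUC act)" "F \<in> LUC act"
  shows "orbit_fun act M F \<in> LUCG"
proof -
  obtain C where C: "0 \<le> C" "\<And>F. F \<in> LUC act \<Longrightarrow> cmod (M F) \<le> C * norm F"
    using dual_space_boundE assms(3) by blast
  have "C-lipschitz_on (LUC act) (orbit_fun act M)"
  proof (rule lipschitz_onI)
    fix H K assume "H \<in> LUC act" "K \<in> LUC act"
    then show "dist (orbit_fun act M H) (orbit_fun act M K) \<le> C * dist H K"
      using norm_orbit_fun_le[OF assms(2,3) _ C, of "H - K"] assms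
      by (simp add: dist_norm orbit_fun_linear diff_in_LUC)
  qed (rule C)
  then have "continuous_on (LUC act) (orbit_fun act M)"
    by (rule lipschitz_on_continuous_on)
  then have "continuous_on UNIV (\<lambda>s. orbit_fun act M (ltranslate act s F))"
    by (rule continuous_on_compose2)
      (use assms in \<open>auto simp: ltranslate_in_LUC\<close>, simp add: LUC_def)
  then show ?thesis
    by (simp add: LUC_def ltranslate_orbit_fun[OF assms])
qed

lemma module_act_in_dual:
  fixes act :: "'g::{topological_group_add, t2_space} \<Rightarrow> 'x::t2_space \<Rightarrow> 'x"
  assumes lc: "locally_compact_space (euclidean :: 'g topology)"
    and A: "g_space act" and m: "m \<in> dual_space LUCG" and M: "M \<in> dual_space (LUC act)"
  shows "module_act act m M \<in> dual_space (LUC act)"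
proof -
  obtain C where C: "0 \<le> C" "\<And>F. F \<in> LUC act \<Longrightarrow> cmod (M F) \<le> C * norm F"
    using dual_space_boundE M by blast
  obtain D where D: "0 \<le> D" "\<And>F. F \<in> LUCG \<Longrightarrow> cmod (m F) \<le> D * norm F"
    using dual_space_boundE m by blast
  note [simp] = orbit_fun_in_LUC[OF lc A M] orbit_fun_linear[OF A M] add_in_LUC[OF A]
    cscale_in_LUC[OF A]
  show ?thesis
  proof (rule dual_spaceI)
    fix F assume F: "F \<in> LUC act"
    show "cmod (module_act act m M F) \<le> D * C * norm F"
      using D(2)[of "orbit_fun act M F"] mult_left_mono[OF norm_orbit_fun_le[OF A M F C] D(1)] F
      by (simp add: module_act_def)
  qed (auto simp: module_act_def dual_space_add[OF m] dual_space_cscale[OF m])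
qed

text \<open>With \<open>orbit_fun (+) m\<close> in the role of \<open>diamond m\<close>, this is the
  associativity needed for products: at \<open>s\<close> both sides equal \<open>m\<close> at the
  translate of \<open>MF\<close> by \<open>s\<close>.\<close>

lemma orbit_fun_module_act:
  fixes act :: "'g::{topological_group_add, t2_space} \<Rightarrow> 'x::t2_space \<Rightarrow> 'x"
  assumes lc: "locally_compact_space (euclidean :: 'g topology)"
    and A: "g_space act" and m: "m \<in> dual_space LUCG" and M: "M \<in> dual_space (LUC act)"
    and F: "F \<in> LUC act"
  shows "orbit_fun act (module_act act m M) F = orbit_fun (+) m (orbit_fun act M F)"
proof (rule bcontfun_eqI)
  fix s
  have "orbit_fun act (module_act act m M) F s = module_act act m M (ltranslate act s F)"
    by (rule apply_orbit_fun[OF A module_act_in_dual[OF lc A m M] F])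
  also have "\<dots> = m (ltranslate (+) s (orbit_fun act M F))"
    by (simp add: module_act_def ltranslate_in_LUC[OF A F] ltranslate_orbit_fun[OF lc A M F])
  also have "\<dots> = orbit_fun (+) m (orbit_fun act M F) s"
    by (rule apply_orbit_fun[OF g_space_self[OF lc] m orbit_fun_in_LUC[OF lc A M F], symmetric])
  finally show "orbit_fun act (module_act act m M) F s = orbit_fun (+) m (orbit_fun act M F) s" .
qed

text \<open>For the group acting on itself, \<open>diamond\<close> and \<open>orbit_fun\<close>
  coincide, so the facts on the module action also cover the product of the dual algebra.\<close>

lemma arens_eq_module_act: "arens m n = module_act (+) m n"
  by (simp add: arens_def module_act_def diamond_def orbit_fun_def fun_eq_iff)

text \<open>The classical fact that a functional vanishing on finitely many kernels' intersection is
  a combination of the corresponding functionals, here evaluations. Vector operations are written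
  with restriction to \<open>S\<close> because \<open>V\<close> will be a set of extensional
  functions.\<close>

lemma functional_sum_of_kernels:
  fixes V :: "('a \<Rightarrow> complex) set" and \<phi> :: "('a \<Rightarrow> complex) \<Rightarrow> complex"
  assumes "finite I" "I \<subseteq> S"
    and comb: "\<And>M N c. M \<in> V \<Longrightarrow> N \<in> V \<Longrightarrow> (\<lambda>i\<in>S. M i + c * N i) \<in> V"
    and lin: "\<And>M N c. M \<in> V \<Longrightarrow> N \<in> V \<Longrightarrow> \<phi> (\<lambda>i\<in>S. M i + c * N i) = \<phi> M + c * \<phi> N"
    and ker: "\<And>M. M \<in> V \<Longrightarrow> (\<And>i. i \<in> I \<Longrightarrow> M i = 0) \<Longrightarrow> \<phi> M = 0"
  shows "\<exists>c. \<forall>M\<in>V. \<phi> M = (\<Sum>i\<in>I. c i * M i)"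
  using assms(1,2) lin ker
proof (induction I arbitrary: \<phi>)
  case empty
  then show ?case by auto
next
  case (insert j I)
  show ?case
  \<comment> \<open>Either the coordinate \<open>j\<close> vanishes wherever those in
    \<open>I\<close> do, and may receive the coefficient 0, or some \<open>N\<close> detects
    \<open>j\<close> alone.\<close>
  proof (cases "\<forall>M\<in>V. (\<forall>i\<in>I. M i = 0) \<longrightarrow> M j = 0")
    case True
    then have "\<exists>c. \<forall>M\<in>V. \<phi> M = (\<Sum>i\<in>I. c i * M i)"
    proof (intro insert.IH)
      show "\<phi> M = 0" if "M \<in> V" "\<And>i. i \<in> I \<Longrightarrow> M i = 0" for M
        using that True by (intro insert.prems(3)) auto
    qed (use insert.prems in auto)
    then obtain c where "\<forall>M\<in>V. \<phi> M = (\<Sum>i\<in>I. c i * M i)" ..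
    with insert.hyps show ?thesis
      by (intro exI[of _ "c(j := 0)"]) (simp, intro ballI sum.cong, auto)
  next
    case False
    then obtain N where N: "N \<in> V" "\<And>i. i \<in> I \<Longrightarrow> N i = 0" "N j \<noteq> 0"
      by blast
    \<comment> \<open>Subtracting the part of \<open>\<phi>\<close> seen along \<open>N\<close>
      leaves a functional that vanishes on the common kernel of \<open>I\<close> only, so the
      induction hypothesis applies to it.\<close>
    define \<psi> where "\<psi> M = \<phi> M - M j / N j * \<phi> N" for M
    have "\<exists>c. \<forall>M\<in>V. \<psi> M = (\<Sum>i\<in>I. c i * M i)"
    proof (rule insert.IH)
      show "I \<subseteq> S" using insert.prems by simp
      show "\<psi> (\<lambda>i\<in>S. M i + c * K i) = \<psi> M + c * \<psi> K" if "M \<in> V" "K \<in> V" for M K c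
      proof -
        have "j \<in> S" using insert.prems(1) by simp
        then show ?thesis
          unfolding \<psi>_def insert.prems(2)[OF that]
          by (simp only: restrict_apply' add_divide_distrib) (simp add: algebra_simps)
      qed
      show "\<psi> M = 0" if "M \<in> V" "\<And>i. i \<in> I \<Longrightarrow> M i = 0" for M
      proof -
        have "\<phi> (\<lambda>i\<in>S. M i + (- M j / N j) * N i) = 0"
          using insert.prems(1) that N by (intro insert.prems(3) comb) auto
        then show ?thesis
          unfolding \<psi>_def insert.prems(2)[OF that(1) N(1)] by simp
      qed
    qed
    then obtain c where c: "\<forall>M\<in>V. \<psi> M = (\<Sum>i\<in>I. c i * M i)" ..
    have "\<phi> M = (\<Sum>i\<in>insert j I. (c(j := \<phi> N / N j)) i * M i)" if "M \<in> V" for M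
    proof -
      have "(\<Sum>i\<in>insert j I. (c(j := \<phi> N / N j)) i * M i) = \<phi> N / N j * M j + (\<Sum>i\<in>I. c i * M i)"
        using insert.hyps by (simp, intro sum.cong) auto
      then show ?thesis
        using c[rule_format, OF that] by (simp add: \<psi>_def algebra_simps)
    qed
    then show ?thesis by blast
  qed
qed

section \<open>The topological centre\<close>

lemma topspace_weak_star [simp]: "topspace (weak_star S) = dual_space S"
  by (auto simp: weak_star_def topspace_subtopology PiE_def dual_space_def)

lemma dual_space_combination:
  assumes A: "g_space act" and M: "M \<in> dual_space (LUC act)" and N: "N \<in> dual_space (LUC act)"
  shows "(\<lambda>F\<in>LUC act. M F + c * N F) \<in> dual_space (LUC act)"
proof -
  obtain C where C: "\<And>F. F \<in> LUC act \<Longrightarrow> cmod (M F) \<le> C * norm F"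
    using dual_space_boundE M by blast
  obtain D where D: "\<And>F. F \<in> LUC act \<Longrightarrow> cmod (N F) \<le> D * norm F"
    using dual_space_boundE N by blast
  show ?thesis
  proof (rule dual_spaceI)
    fix F assume F: "F \<in> LUC act"
    have "cmod (M F + c * N F) \<le> cmod (M F) + cmod c * cmod (N F)"
      by (metis norm_mult norm_triangle_ineq)
    also have "\<dots> \<le> C * norm F + cmod c * (D * norm F)"
      by (intro add_mono mult_left_mono C D F) auto
    finally show "cmod ((\<lambda>F\<in>LUC act. M F + c * N F) F) \<le> (C + cmod c * D) * norm F"
      using F by (simp add: algebra_simps)
  qed (auto simp: add_in_LUC[OF A] cscale_in_LUC[OF A] dual_space_add[OF M] dual_space_add[OF N]
      dual_space_cscale[OF M] dual_space_cscale[OF N] algebra_simps)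
qed

text \<open>Continuity at zero bounds \<open>\<phi>\<close> by 1 on a basic neighbourhood, which
  restricts finitely many coordinates. All multiples of an \<open>M\<close> vanishing at these stay
  inside, so \<open>\<phi> M = 0\<close>, and the kernel lemma applies.\<close>

lemma weak_star_continuous_functional:
  assumes A: "g_space act"
    and cont: "continuous_map (weak_star (LUC act)) euclidean \<phi>"
    and lin: "\<And>M N c. M \<in> dual_space (LUC act) \<Longrightarrow> N \<in> dual_space (LUC act) \<Longrightarrow>
      \<phi> (\<lambda>F\<in>LUC act. M F + c * N F) = \<phi> M + c * \<phi> N"
  shows "\<exists>F\<in>LUC act. \<forall>M\<in>dual_space (LUC act). \<phi> M = M F"
proof -
  let ?S = "LUC act"
  let ?V = "dual_space ?S"
  define Z :: "('b \<Rightarrow>\<^sub>C complex) \<Rightarrow> complex" where "Z = (\<lambda>F\<in>?S. 0)"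
  have Z: "Z \<in> ?V"
    unfolding Z_def by (rule dual_spaceI[where C = 0]) (auto simp: add_in_LUC[OF A] cscale_in_LUC[OF A])
  \<comment> \<open>Since \<open>Z + Z = Z\<close>, linearity gives
    \<open>\<phi> Z = \<phi> Z + \<phi> Z\<close>.\<close>
  have "\<phi> Z = 0"
    using lin[OF Z Z, of 1] by (simp add: Z_def cong: restrict_cong)
  have "openin (weak_star ?S) {M \<in> ?V. \<phi> M \<in> ball 0 1}"
    using openin_continuous_map_preimage[OF cont, of "ball 0 1"]
    by (simp only: topspace_weak_star open_openin[symmetric] open_ball)
  then obtain T where T: "openin (product_topology (\<lambda>_. euclidean) ?S) T"
    "{M \<in> ?V. \<phi> M \<in> ball 0 1} = T \<inter> ?V"
    unfolding weak_star_def openin_subtopology by (elim exE conjE)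
  have "Z \<in> {M \<in> ?V. \<phi> M \<in> ball 0 1}"
    using Z \<open>\<phi> Z = 0\<close> by simp
  then have "Z \<in> T"
    unfolding T(2) by (rule IntD1)
  then obtain X where X: "finite {F \<in> ?S. X F \<noteq> UNIV}" "Z \<in> Pi\<^sub>E ?S X" "Pi\<^sub>E ?S X \<subseteq> T"
    using T(1) unfolding openin_product_topology_alt topspace_euclidean by (meson bspec)
  define I where "I = {F \<in> ?S. X F \<noteq> UNIV}"
  have I: "finite I" "I \<subseteq> ?S"
    using X(1) by (auto simp: I_def)
  have "\<exists>c. \<forall>M\<in>?V. \<phi> M = (\<Sum>F\<in>I. c F * M F)"
  proof (rule functional_sum_of_kernels[OF I])
    show "(\<lambda>F\<in>?S. M F + c * N F) \<in> ?V" if "M \<in> ?V" "N \<in> ?V" for M N c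
      using that by (rule dual_space_combination[OF A])
    fix M assume M: "M \<in> ?V" and M0: "\<And>F. F \<in> I \<Longrightarrow> M F = 0"
    have small: "cmod (c * \<phi> M) < 1" for c
    proof -
      let ?K = "\<lambda>F\<in>?S. Z F + c * M F"
      have K: "?K \<in> ?V"
        by (rule dual_space_combination[OF A Z M])
      have "?K \<in> Pi\<^sub>E ?S X"
      proof
        fix F assume F: "F \<in> ?S"
        show "?K F \<in> X F"
        proof (cases "F \<in> I")
          case True
          then show ?thesis using F M0 PiE_mem[OF X(2) F] by simp
        next
          case False
          then show ?thesis using F by (simp add: I_def)
        qed
      qed auto
      then have "?K \<in> {M \<in> ?V. \<phi> M \<in> ball 0 1}"
        using X(3) K T(2) by blast
      then show ?thesis
        using lin[OF Z M, of c] \<open>\<phi> Z = 0\<close> by simp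
    qed
    show "\<phi> M = 0"
      \<comment> \<open>If \<open>\<phi> M\<close> were nonzero, this scaling would produce the
        value 1, outside the open unit ball.\<close>
      using small[of "inverse (\<phi> M)"] by (cases "\<phi> M = 0") auto
  qed (rule lin)
  then obtain c where c: "\<forall>M\<in>?V. \<phi> M = (\<Sum>F\<in>I. c F * M F)" ..
  show ?thesis
    by (rule bexI[OF _ LUC_sum(1)[OF A I, of c]]) (simp add: c LUC_sum(2)[OF A I])
qed

text \<open>The \<^class>\<open>complete_space\<close> instance of the type of bounded continuous functions needs a metric domain.\<close>

lemma Cauchy_bcontfun_tendsto:
  fixes R :: "nat \<Rightarrow> ('a::topological_space \<Rightarrow>\<^sub>C 'b::complete_space)"
  assumes "Cauchy R"
  obtains H where "R \<longlonglongrightarrow> H"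
proof -
  have "uniformly_Cauchy_on UNIV (\<lambda>n. apply_bcontfun (R n))"
    unfolding uniformly_Cauchy_on_def
  proof (intro allI impI)
    fix e :: real assume "0 < e"
    then obtain N where "\<And>m n. N \<le> m \<Longrightarrow> N \<le> n \<Longrightarrow> dist (R m) (R n) < e"
      using assms unfolding Cauchy_def by meson
    then show "\<exists>N. \<forall>x\<in>UNIV. \<forall>m\<ge>N. \<forall>n\<ge>N. dist (R m x) (R n x) < e"
      by (blast intro: dist_fun_lt_imp_dist_val_lt)
  qed
  then obtain h where "uniform_limit UNIV R h sequentially"
    using Cauchy_uniformly_convergent by (auto simp: uniformly_convergent_on_def)
  from uniform_limit_bcontfunE[OF this sequentially_bot] show thesis
    using that by metis
qed

section \<open>The companion criterion and closure under the algebra operations\<close>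

context
  fixes act :: "'g::{topological_group_add, t2_space} \<Rightarrow> 'x::t2_space \<Rightarrow> 'x"
  assumes lc: "locally_compact_space (euclidean :: 'g topology)"
    and A: "g_space act"
begin

text \<open>From left to right, the coordinate of \<open>module_act act m M\<close> at
  \<open>F\<close> is a weak* continuous linear functional of \<open>M\<close>, hence an evaluation.
  Conversely, continuity into a topology of pointwise convergence is checked coordinatewise, and
  evaluation at \<open>H\<close> is continuous.\<close>

lemma top_centre_iff:
  "m \<in> top_centre act \<longleftrightarrow> m \<in> dual_space LUCG \<and>
    (\<forall>F\<in>LUC act. \<exists>H\<in>LUC act. \<forall>M\<in>dual_space (LUC act). m (orbit_fun act M F) = M H)"
    (is "?L \<longleftrightarrow> ?m \<and> ?R")
proof (intro iffI conjI ballI; (elim conjE)?)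
  assume ?L
  then show m: ?m
    by (simp add: top_centre_def)
  fix F assume F: "F \<in> LUC act"
  have "continuous_map (weak_star (LUC act)) euclidean (\<lambda>M. module_act act m M F)"
  proof -
    have "continuous_map (weak_star (LUC act)) (weak_star (LUC act)) (module_act act m)"
      using \<open>?L\<close> by (simp add: top_centre_def)
    then have "continuous_map (weak_star (LUC act)) (product_topology (\<lambda>_. euclidean) (LUC act))
        (module_act act m)"
      by (subst (asm) (2) weak_star_def) (simp only: continuous_map_in_subtopology)
    then show ?thesis
      using F by (simp only: continuous_map_componentwise)
  qed
  then have cont: "continuous_map (weak_star (LUC act)) euclidean (\<lambda>M. m (orbit_fun act M F))"
    using F by (simp add: module_act_def)
  show "\<exists>H\<in>LUC act. \<forall>M\<in>dual_space (LUC act). m (orbit_fun act M F) = M H"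
  proof (rule weak_star_continuous_functional[OF A cont])
    fix M N c assume M: "M \<in> dual_space (LUC act)" and N: "N \<in> dual_space (LUC act)"
    note K = dual_space_combination[OF A M N, of c]
    have "orbit_fun act (\<lambda>F\<in>LUC act. M F + c * N F) F
      = orbit_fun act M F + cscale c (orbit_fun act N F)"
      by (rule bcontfun_eqI)
        (simp add: apply_orbit_fun[OF A K F] apply_orbit_fun[OF A M F] apply_orbit_fun[OF A N F]
          apply_cscale ltranslate_in_LUC[OF A F])
    then show "m (orbit_fun act (\<lambda>F\<in>LUC act. M F + c * N F) F)
      = m (orbit_fun act M F) + c * m (orbit_fun act N F)"
      by (simp add: dual_space_add[OF m] dual_space_cscale[OF m] orbit_fun_in_LUC[OF lc A] M N F
        cscale_in_LUC[OF g_space_self[OF lc]])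
  qed
next
  assume m: ?m and R: ?R
  have "continuous_map (weak_star (LUC act)) euclidean (\<lambda>M. module_act act m M F)"
    if F: "F \<in> LUC act" for F
  proof -
    obtain H where H: "H \<in> LUC act" "\<forall>M\<in>dual_space (LUC act). m (orbit_fun act M F) = M H"
      using R F by blast
    have "continuous_map (weak_star (LUC act)) euclidean (\<lambda>M. M H)"
      unfolding weak_star_def
      using H(1) by (intro continuous_map_from_subtopology continuous_map_product_projection)
    then show ?thesis
      by (rule continuous_map_eq) (use F H in \<open>auto simp: module_act_def\<close>)
  qed
  moreover have "module_act act m M \<in> dual_space (LUC act)" if "M \<in> dual_space (LUC act)" for M
    by (rule module_act_in_dual[OF lc A m that])
  ultimately have "continuous_map (weak_star (LUC act))
      (subtopology (product_topology (\<lambda>_. euclidean) (LUC act)) (dual_space (LUC act))) (module_act act m)"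
    unfolding continuous_map_in_subtopology continuous_map_componentwise topspace_weak_star
    by (auto intro: dual_space_extensional)
  then show ?L
    using m by (simp only: top_centre_def flip: weak_star_def) simp
qed

lemma point_evaluation_in_dual: "(\<lambda>F\<in>LUC act. apply_bcontfun F x) \<in> dual_space (LUC act)"
  by (rule dual_spaceI[where C = 1])
    (auto simp: add_in_LUC[OF A] cscale_in_LUC[OF A] apply_cscale norm_bounded)

text \<open>Point evaluations have norm at most 1, so the approximants \<open>R\<close> of a fixed \<open>F\<close> form a
  Cauchy net in the supremum norm; this replaces the Krein-Smulian theorem.\<close>

lemma top_centreI_approx:
  assumes m: "m \<in> dual_space LUCG"
    and approx: "\<And>F e. F \<in> LUC act \<Longrightarrow> 0 < e \<Longrightarrow>
      \<exists>R\<in>LUC act. \<forall>M\<in>dual_space (LUC act). \<forall>C\<ge>0. (\<forall>H\<in>LUC act. cmod (M H) \<le> C * norm H) \<longrightarrow>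
        cmod (m (orbit_fun act M F) - M R) \<le> e * C"
  shows "m \<in> top_centre act"
  unfolding top_centre_iff
proof (intro conjI ballI)
  fix F assume F: "F \<in> LUC act"
  have "\<forall>k. \<exists>R\<in>LUC act. \<forall>M\<in>dual_space (LUC act). \<forall>C\<ge>0. (\<forall>H\<in>LUC act. cmod (M H) \<le> C * norm H) \<longrightarrow>
        cmod (m (orbit_fun act M F) - M R) \<le> inverse (real (Suc k)) * C"
    using approx[OF F] by simp
  then obtain R where R: "\<And>k. R k \<in> LUC act"
    and app: "\<And>k M C. M \<in> dual_space (LUC act) \<Longrightarrow> 0 \<le> C \<Longrightarrow> (\<And>H. H \<in> LUC act \<Longrightarrow> cmod (M H) \<le> C * norm H) \<Longrightarrow>
        cmod (m (orbit_fun act M F) - M (R k)) \<le> inverse (real (Suc k)) * C"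
    by metis
  have close: "norm (R k - R l) \<le> inverse (real (Suc k)) + inverse (real (Suc l))" for k l
  proof (rule norm_bound)
    fix x
    let ?M = "\<lambda>F\<in>LUC act. apply_bcontfun F x"
    \<comment> \<open>This number does not depend on \<open>k\<close>: every \<open>R k\<close>
      approximates it at \<open>x\<close>, with the constant 1 for the point evaluation.\<close>
    let ?v = "m (orbit_fun act ?M F)"
    have "cmod (?v - ?M (R k)) \<le> inverse (real (Suc k)) * 1" for k
      by (rule app[OF point_evaluation_in_dual]) (auto simp: norm_bounded)
    then have "cmod (?v - R k x) \<le> inverse (real (Suc k))" for k
      using R by (simp del: of_nat_Suc)
    from this[of k] this[of l] have "cmod ((?v - R l x) - (?v - R k x)) \<le> inverse (real (Suc k)) + inverse (real (Suc l))"
      using norm_triangle_ineq4[of "?v - R l x" "?v - R k x"] by linarith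
    then show "norm (apply_bcontfun (R k - R l) x) \<le> inverse (real (Suc k)) + inverse (real (Suc l))"
      by simp
  qed
  have "Cauchy R"
  proof (rule CauchyI)
    fix e :: real assume "0 < e"
    then obtain N where N: "inverse (real (Suc N)) < e / 2"
      using reals_Archimedean[of "e / 2"] by auto
    have "norm (R k - R l) < e" if "k \<ge> N" "l \<ge> N" for k l
    proof -
      have "inverse (real (Suc j)) \<le> inverse (real (Suc N))" if "j \<ge> N" for j
        using that by (intro le_imp_inverse_le) auto
      from close[of k l] this[OF that(1)] this[OF that(2)] N show ?thesis by linarith
    qed
    then show "\<exists>N. \<forall>k\<ge>N. \<forall>l\<ge>N. norm (R k - R l) < e" by blast
  qed
  then obtain H where H: "R \<longlonglongrightarrow> H"
    by (rule Cauchy_bcontfun_tendsto)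
  have HL: "H \<in> LUC act"
    by (rule closed_sequentially[OF closed_LUC[OF A] R H])
  have "m (orbit_fun act M F) = M H" if M: "M \<in> dual_space (LUC act)" for M
  proof -
    obtain C where C: "0 \<le> C" "\<And>F. F \<in> LUC act \<Longrightarrow> cmod (M F) \<le> C * norm F"
      using dual_space_boundE M by blast
    \<comment> \<open>The first term is the approximation error of \<open>R k\<close>, the second
      the cost under \<open>M\<close> of replacing \<open>R k\<close> by its limit.\<close>
    have zero: "(\<lambda>k. inverse (real (Suc k)) * C + C * norm (R k - H)) \<longlonglongrightarrow> 0 * C + C * 0"
      using H by (intro tendsto_intros LIMSEQ_inverse_real_of_nat) (simp add: LIM_zero tendsto_norm_zero)
    have "cmod (m (orbit_fun act M F) - M H) \<le> inverse (real (Suc k)) * C + C * norm (R k - H)" for k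
    proof -
      have "cmod (M (R k) - M H) \<le> C * norm (R k - H)"
        using C(2)[of "R k - H"] by (simp add: diff_in_LUC[OF A] R HL dual_space_diff[OF A M])
      then show ?thesis
        using app[OF M C, of k] norm_triangle_ineq[of "m (orbit_fun act M F) - M (R k)" "M (R k) - M H"]
        by simp
    qed
    then have "cmod (m (orbit_fun act M F) - M H) \<le> 0"
      using zero by (intro LIMSEQ_le_const[OF zero[simplified]]) auto
    then show ?thesis by simp
  qed
  then show "\<exists>H\<in>LUC act. \<forall>M\<in>dual_space (LUC act). m (orbit_fun act M F) = M H"
    using HL by blast
qed (rule m)

lemma subalgebra_top_centre: "is_subalgebra (top_centre act)"
proof -
  note G = g_space_self[OF lc]
  have sub: "m \<in> dual_space LUCG" if "m \<in> top_centre act" for m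
    using that by (simp add: top_centre_def)
  have rep: "\<exists>H\<in>LUC act. \<forall>M\<in>dual_space (LUC act). m (orbit_fun act M F) = M H"
    if "m \<in> top_centre act" "F \<in> LUC act" for m F
    using that by (simp add: top_centre_iff)
  have zero: "(\<lambda>f\<in>LUCG. 0) \<in> top_centre act"
    unfolding top_centre_iff
    by (auto intro!: dual_spaceI[where C = 0] bexI[OF _ zero_in_LUC[OF A]]
      simp: add_in_LUC[OF G] cscale_in_LUC[OF G] orbit_fun_in_LUC[OF lc A] dual_space_zero[OF A])
  have comb: "(\<lambda>f\<in>LUCG. m f + c * n f) \<in> top_centre act"
    if m: "m \<in> top_centre act" and n: "n \<in> top_centre act" for m n c
    unfolding top_centre_iff
  proof (intro conjI ballI)
    show "(\<lambda>f\<in>LUCG. m f + c * n f) \<in> dual_space LUCG"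
      by (intro dual_space_combination[OF G] sub m n)
    fix F assume F: "F \<in> LUC act"
    obtain H K where "H \<in> LUC act" "\<forall>M\<in>dual_space (LUC act). m (orbit_fun act M F) = M H"
      "K \<in> LUC act" "\<forall>M\<in>dual_space (LUC act). n (orbit_fun act M F) = M K"
      using rep[OF m F] rep[OF n F] by blast
    then show "\<exists>H\<in>LUC act. \<forall>M\<in>dual_space (LUC act).
        (\<lambda>f\<in>LUCG. m f + c * n f) (orbit_fun act M F) = M H"
      using F by (intro bexI[of _ "H + cscale c K"])
        (auto simp: orbit_fun_in_LUC[OF lc A] add_in_LUC[OF A] cscale_in_LUC[OF A]
          dual_space_add dual_space_cscale)
  qed
  have "arens m n \<in> top_centre act" if m: "m \<in> top_centre act" and n: "n \<in> top_centre act" for m n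
    unfolding top_centre_iff
  proof (intro conjI ballI)
    show "arens m n \<in> dual_space LUCG"
      unfolding arens_eq_module_act by (intro module_act_in_dual[OF lc G] sub m n)
    fix F assume F: "F \<in> LUC act"
    \<comment> \<open>Companions are taken twice: \<open>H\<close> is that of \<open>F\<close> for
      \<open>m\<close>, and \<open>K\<close> that of \<open>H\<close> for \<open>n\<close>. Then
      \<open>m\<close> at \<open>(n . M)F\<close> is \<open>n . M\<close> at \<open>H\<close>, which
      is \<open>n\<close> at \<open>MH\<close>, which is \<open>M K\<close>.\<close>
    obtain H where H: "H \<in> LUC act" "\<forall>M\<in>dual_space (LUC act). m (orbit_fun act M F) = M H"
      using rep[OF m F] by blast
    obtain K where K: "K \<in> LUC act" "\<forall>M\<in>dual_space (LUC act). n (orbit_fun act M H) = M K"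
      using rep[OF n H(1)] by blast
    have "arens m n (orbit_fun act M F) = M K" if M: "M \<in> dual_space (LUC act)" for M
    proof -
      have "arens m n (orbit_fun act M F) = m (orbit_fun act (module_act act n M) F)"
        unfolding orbit_fun_module_act[OF lc A sub[OF n] M F]
        by (simp add: arens_eq_module_act module_act_def orbit_fun_in_LUC[OF lc A M F])
      also have "\<dots> = module_act act n M H"
        using H(2) module_act_in_dual[OF lc A sub[OF n] M] by blast
      also have "\<dots> = M K"
        using K(2) H(1) M by (simp add: module_act_def)
      finally show ?thesis .
    qed
    then show "\<exists>H\<in>LUC act. \<forall>M\<in>dual_space (LUC act). arens m n (orbit_fun act M F) = M H"
      using K(1) by blast
  qed
  moreover have "(\<lambda>f\<in>LUCG. m f + n f) \<in> top_centre act"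
    if "m \<in> top_centre act" "n \<in> top_centre act" for m n
    using comb[OF that, of 1] by simp
  moreover have "(\<lambda>f\<in>LUCG. c * m f) \<in> top_centre act" if "m \<in> top_centre act" for m c
    using comb[OF zero that, of c] by (simp cong: restrict_cong)
  ultimately show ?thesis
    using zero sub by (auto simp: is_subalgebra_def)
qed

end

section \<open>Norm closedness of the topological centre\<close>

lemma norm_le_dual_dist:
  assumes A: "g_space act" and m: "m \<in> dual_space (LUC act)" and n: "n \<in> dual_space (LUC act)"
    and F: "F \<in> LUC act"
  shows "cmod (m F - n F) \<le> dual_dist (LUC act) m n * norm F"
proof (cases "F = 0")
  case True
  then show ?thesis by (simp add: dual_space_zero[OF A] m n)
next
  case False
  obtain C where C: "0 \<le> C" "\<And>F. F \<in> LUC act \<Longrightarrow> cmod (m F) \<le> C * norm F"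
    using dual_space_boundE m by blast
  obtain D where D: "0 \<le> D" "\<And>F. F \<in> LUC act \<Longrightarrow> cmod (n F) \<le> D * norm F"
    using dual_space_boundE n by blast
  let ?B = "{F \<in> LUC act. norm F \<le> 1}"
  \<comment> \<open>A real supremum dominates its members only over a set that is bounded
    above.\<close>
  have "bdd_above ((\<lambda>F. cmod ((\<lambda>F\<in>LUC act. m F - n F) F)) ` ?B)"
  proof (rule bdd_aboveI2)
    fix F assume F: "F \<in> ?B"
    then have "cmod (m F) \<le> C" "cmod (n F) \<le> D"
      using order_trans[OF C(2)[of F] mult_left_le[of "norm F" C]]
        order_trans[OF D(2)[of F] mult_left_le[of "norm F" D]] C(1) D(1) by auto
    then show "cmod ((\<lambda>F\<in>LUC act. m F - n F) F) \<le> C + D"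
      using F norm_triangle_ineq4[of "m F" "n F"] by simp
  qed
  then have le: "cmod ((\<lambda>F\<in>LUC act. m F - n F) H) \<le> dual_dist (LUC act) m n" if "H \<in> ?B" for H
    unfolding dual_dist_def dual_norm_def using that m n by (auto intro: cSUP_upper2)
  define c where "c = complex_of_real (inverse (norm F))"
  have "norm (cscale c F) \<le> 1"
    using norm_cscale[of c F] False by (simp add: c_def norm_inverse)
  then have "cmod (m (cscale c F) - n (cscale c F)) \<le> dual_dist (LUC act) m n"
    using le[of "cscale c F"] cscale_in_LUC[OF A F] by simp
  moreover have "m (cscale c F) - n (cscale c F) = c * (m F - n F)"
    using F by (simp add: dual_space_cscale[OF m] dual_space_cscale[OF n] algebra_simps)
  ultimately have "cmod (c * (m F - n F)) \<le> dual_dist (LUC act) m n"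
    by (simp only:)
  moreover have "cmod (c * (m F - n F)) = inverse (norm F) * cmod (m F - n F)"
    by (simp add: norm_mult norm_inverse c_def)
  ultimately have "inverse (norm F) * cmod (m F - n F) \<le> dual_dist (LUC act) m n"
    by (simp only:)
  then show ?thesis
    using False by (simp add: field_simps)
qed

text \<open>The companion of a nearby \<open>n\<close> serves as approximant for \<open>m\<close>,
  because the error is at most the distance of \<open>m\<close> and \<open>n\<close> times the norm
  of \<open>MF\<close>, which is at most \<open>C * norm F\<close>.\<close>

lemma closedin_top_centre:
  fixes act :: "'g::{topological_group_add, t2_space} \<Rightarrow> 'x::t2_space \<Rightarrow> 'x"
  assumes lc: "locally_compact_space (euclidean :: 'g topology)" and A: "g_space act"
  shows "closedin (norm_topology (LUCG :: ('g \<Rightarrow>\<^sub>C complex) set)) (top_centre act)"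
proof -
  note G = g_space_self[OF lc]
  interpret Metric_space "dual_space (LUCG :: ('g \<Rightarrow>\<^sub>C complex) set)" "dual_dist LUCG"
    by (rule Metric_space_dual[OF G])
  \<comment> \<open>Contrapositive of the metric form of closedness: a functional all of whose balls
    meet the centre belongs to it.\<close>
  have "m \<in> top_centre act"
    if m: "m \<in> dual_space LUCG" and near: "\<And>r. 0 < r \<Longrightarrow> \<not> disjnt (top_centre act) (mball m r)" for m
  proof (rule top_centreI_approx[OF lc A m])
    fix F e assume F: "F \<in> LUC act" and e: "0 < (e :: real)"
    \<comment> \<open>Chosen so that \<open>r * (C * norm F)\<close> is at most
      \<open>e * C\<close>; the added 1 covers \<open>F = 0\<close>.\<close>
    define r where "r = e / (norm F + 1)"
    have pos: "0 < norm F + 1"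
      by (simp add: add_nonneg_pos)
    then have "0 < r"
      using e by (simp add: r_def)
    then obtain n where n: "n \<in> top_centre act" "dual_dist LUCG m n < r"
      using near[of r] by (auto simp: disjnt_iff)
    have nd: "n \<in> dual_space LUCG"
      using n by (simp add: top_centre_def)
    obtain R where R: "R \<in> LUC act" "\<forall>M\<in>dual_space (LUC act). n (orbit_fun act M F) = M R"
      using n(1) F by (auto simp: top_centre_iff[OF lc A])
    have "cmod (m (orbit_fun act M F) - M R) \<le> e * C"
      if M: "M \<in> dual_space (LUC act)" "0 \<le> C" "\<forall>H\<in>LUC act. cmod (M H) \<le> C * norm H" for M C
    proof -
      have "cmod (m (orbit_fun act M F) - M R) \<le> dual_dist LUCG m n * norm (orbit_fun act M F)"
        using norm_le_dual_dist[OF G m nd orbit_fun_in_LUC[OF lc A M(1) F]] R(2) M(1) by simp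
      also have "\<dots> \<le> r * (C * norm F)"
        using n(2) \<open>0 < r\<close> norm_orbit_fun_le[OF A M(1) F M(2)] M(3) by (intro mult_mono) auto
      also have "\<dots> = (r * norm F) * C"
        by simp
      also have "\<dots> \<le> e * C"
      proof (rule mult_right_mono[OF _ M(2)])
        have "r * norm F \<le> r * (norm F + 1)"
          using \<open>0 < r\<close> by simp
        then show "r * norm F \<le> e"
          using pos by (simp add: r_def)
      qed
      finally show ?thesis .
    qed
    then show "\<exists>R\<in>LUC act. \<forall>M\<in>dual_space (LUC act). \<forall>C\<ge>0. (\<forall>H\<in>LUC act. cmod (M H) \<le> C * norm H) \<longrightarrow>
        cmod (m (orbit_fun act M F) - M R) \<le> e * C"
      using R(1) by blast
  qed
  then have "\<exists>r>0. disjnt (top_centre act) (mball m r)" if "m \<in> dual_space LUCG - top_centre act" for m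
    using that by auto
  moreover have "top_centre act \<subseteq> dual_space LUCG"
    unfolding top_centre_def by (rule Collect_restrict)
  ultimately show ?thesis
    unfolding norm_topology_def closedin_metric by (intro conjI allI impI)
qed

section \<open>Variations of complex measures\<close>

text \<open>Values lie in any normed space, so that a complex measure and its real images under
  bounded linear maps fall under one notion.\<close>

locale vector_measure =
  fixes M :: "'a measure" and \<nu> :: "'a set \<Rightarrow> 'b::real_normed_vector"
  assumes sums_disjoint: "range A \<subseteq> sets M \<Longrightarrow> disjoint_family A \<Longrightarrow> (\<lambda>n. \<nu> (A n)) sums \<nu> (\<Union>n. A n)"
begin

text \<open>The constant sequence of empty sets is disjoint, and a convergent constant series has
  zero terms.\<close>

lemma vm_empty [simp]: "\<nu> {} = 0"
  using sums_summable[OF sums_disjoint[of "\<lambda>_. {}"]] by (simp add: disjoint_family_on_def summable_const_iff)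

lemma vm_Un:
  assumes "A \<in> sets M" "B \<in> sets M" "A \<inter> B = {}"
  shows "\<nu> (A \<union> B) = \<nu> A + \<nu> B"
proof (rule sums_unique2)
  show "(\<lambda>n. \<nu> (binaryset A B n)) sums (\<nu> A + \<nu> B)"
    by (rule binaryset_sums) simp
  show "(\<lambda>n. \<nu> (binaryset A B n)) sums \<nu> (A \<union> B)"
    unfolding UN_binaryset_eq[symmetric]
    using assms by (intro sums_disjoint) (auto simp: range_binaryset_eq disjoint_family_on_def binaryset_def)
qed

lemma vm_Diff:
  assumes "A \<in> sets M" "B \<in> sets M" "B \<subseteq> A"
  shows "\<nu> (A - B) = \<nu> A - \<nu> B"
proof -
  have "\<nu> (B \<union> (A - B)) = \<nu> B + \<nu> (A - B)"
    using assms by (intro vm_Un) auto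
  moreover have "B \<union> (A - B) = A"
    using assms(3) by blast
  ultimately show ?thesis
    by simp
qed

text \<open>If \<open>\<nu>\<close> were unbounded, one could split off disjoint sets of measure at least 1 in norm forever,
  contradicting the convergence of the series of their measures.\<close>

lemma vm_bounded: "\<exists>K. \<forall>A\<in>sets M. norm (\<nu> A) \<le> K"
proof (rule ccontr)
  define unb where "unb E \<longleftrightarrow> (\<forall>K. \<exists>B\<in>sets M. B \<subseteq> E \<and> norm (\<nu> B) > K)" for E
  assume "\<not> ?thesis"
  then have top: "unb (space M)"
    unfolding unb_def by (meson not_le sets.sets_into_space)
  have step: "\<exists>E'. (E' \<in> sets M \<and> unb E') \<and> (E' \<subseteq> E \<and> 1 \<le> norm (\<nu> (E - E')))"
    if E: "E \<in> sets M" "unb E" for E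
  proof -
    \<comment> \<open>The margin makes both pieces large: \<open>\<nu> B\<close> and, by
      subtraction, \<open>\<nu> (E - B)\<close> have norm at least 1.\<close>
    obtain B where B: "B \<in> sets M" "B \<subseteq> E" "norm (\<nu> B) > norm (\<nu> E) + 1"
      using E(2) unfolding unb_def by blast
    have "norm (\<nu> B) - norm (\<nu> E) \<le> norm (\<nu> (E - B))"
      using norm_triangle_ineq2[of "\<nu> B" "\<nu> E"] by (simp add: vm_Diff[OF E(1) B(1,2)] norm_minus_commute)
    then have "1 \<le> norm (\<nu> (E - B))" "1 \<le> norm (\<nu> B)"
      using B(3) norm_ge_zero[of "\<nu> E"] by linarith+
    moreover have "E - (E - B) = B"
      using B(2) by blast
    \<comment> \<open>The piece that inherits unboundedness becomes \<open>E'\<close>, and the other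
      one is split off.\<close>
    moreover have "unb B \<or> unb (E - B)"
    proof (rule ccontr)
      assume "\<not> ?thesis"
      then obtain K L where KL: "\<And>C. C \<in> sets M \<Longrightarrow> C \<subseteq> B \<Longrightarrow> norm (\<nu> C) \<le> K"
        "\<And>C. C \<in> sets M \<Longrightarrow> C \<subseteq> E - B \<Longrightarrow> norm (\<nu> C) \<le> L"
        unfolding unb_def by (meson not_le)
      obtain C where C: "C \<in> sets M" "C \<subseteq> E" "norm (\<nu> C) > K + L"
        using E(2) unfolding unb_def by blast
      have "\<nu> ((C \<inter> B) \<union> (C - B)) = \<nu> (C \<inter> B) + \<nu> (C - B)"
        using C(1) B(1) by (intro vm_Un) auto
      moreover have "(C \<inter> B) \<union> (C - B) = C"
        by blast
      moreover have "norm (\<nu> (C \<inter> B)) \<le> K" "norm (\<nu> (C - B)) \<le> L"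
        using C B(1) by (auto intro: KL)
      ultimately show False
        using C(3) norm_triangle_ineq[of "\<nu> (C \<inter> B)" "\<nu> (C - B)"] by simp
    qed
    ultimately show ?thesis
      using B(1,2) E(1) by (metis Diff_subset sets.Diff)
  qed
  obtain E where E: "\<And>n. E n \<in> sets M" "\<And>n. E (Suc n) \<subseteq> E n" "\<And>n. 1 \<le> norm (\<nu> (E n - E (Suc n)))"
    using dependent_nat_choice[of "\<lambda>n E. E \<in> sets M \<and> unb E" "\<lambda>n E E'. E' \<subseteq> E \<and> 1 \<le> norm (\<nu> (E - E'))"]
      top step by (metis sets.top)
  define D where "D n = E n - E (Suc n)" for n
  have "D m \<inter> D n = {}" if "m < n" for m n
    using lift_Suc_antimono_le[of E "Suc m" n] E(2) that by (auto simp: D_def)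
  then have disj: "disjoint_family D"
    unfolding disjoint_family_on_def by (metis inf_commute linorder_neqE_nat)
  have "range D \<subseteq> sets M"
    using E(1) by (auto simp: D_def)
  from sums_summable[OF sums_disjoint[OF this disj]] have "(\<lambda>n. \<nu> (D n)) \<longlonglongrightarrow> 0"
    by (rule summable_LIMSEQ_zero)
  then have "(\<lambda>n. norm (\<nu> (D n))) \<longlonglongrightarrow> 0"
    by (rule tendsto_norm_zero)
  then have "1 \<le> (0::real)"
    by (rule LIMSEQ_le_const) (use E(3) in \<open>auto simp: D_def\<close>)
  then show False by simp
qed

end

lemma vector_measure_bounded_linear:
  assumes "vector_measure M \<nu>" "bounded_linear h"
  shows "vector_measure M (\<lambda>E. h (\<nu> E))"
  using assms bounded_linear.sums[OF assms(2)] by (simp add: vector_measure_def)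

section \<open>The positive variation as a finite measure\<close>

context
  fixes \<nu> :: "'a::topological_space set \<Rightarrow> real"
  assumes vm: "vector_measure borel \<nu>"
begin

interpretation vector_measure borel \<nu>
  by (rule vm)

text \<open>The set function inside \<open>positive_variation\<close>. It must be shown to be a
  measure before \<open>emeasure\<close> can be computed, since \<open>measure_of\<close> replaces
  anything else by zero.\<close>

private abbreviation (input) pv :: "'a set \<Rightarrow> ennreal" where
  "pv E \<equiv> SUP B\<in>{B \<in> sets borel. B \<subseteq> E}. ennreal (\<nu> B)"

private lemma pv_mono: "E \<subseteq> F \<Longrightarrow> pv E \<le> pv F"
  by (intro SUP_subset_mono) auto

text \<open>Subsets of \<open>A\<close> and of \<open>B\<close> unite to a subset of the union.
  Because \<open>ennreal\<close> truncates, their values add as wanted only if both are nonnegative;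
  otherwise a nonpositive one counts as 0 and is dropped.\<close>

private lemma pv_superadditive:
  assumes "A \<in> sets borel" "B \<in> sets borel" "A \<inter> B = {}"
  shows "pv A + pv B \<le> pv (A \<union> B)"
proof -
  let ?S = "\<lambda>E. {B \<in> sets borel. B \<subseteq> E}"
  have ne: "?S E \<noteq> {}" for E :: "'a set"
    by auto
  have le: "ennreal (\<nu> C) + ennreal (\<nu> D) \<le> pv (A \<union> B)" if C: "C \<in> ?S A" and D: "D \<in> ?S B" for C D
  proof -
    have up: "ennreal (\<nu> E) \<le> pv (A \<union> B)" if "E \<in> ?S (A \<union> B)" for E
      using that by (rule SUP_upper)
    consider "\<nu> C \<le> 0" | "\<nu> D \<le> 0" | "0 \<le> \<nu> C" "0 \<le> \<nu> D"
      by linarith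
    then show ?thesis
    proof cases
      case 1
      then show ?thesis using up[of D] D by (auto simp: ennreal_neg)
    next
      case 2
      then show ?thesis using up[of C] C by (auto simp: ennreal_neg)
    next
      case 3
      have "\<nu> (C \<union> D) = \<nu> C + \<nu> D"
        using C D assms by (intro vm_Un) auto
      then show ?thesis using up[of "C \<union> D"] C D 3 by (auto simp: ennreal_plus)
    qed
  qed
  have "pv A + pv B = (SUP C\<in>?S A. ennreal (\<nu> C) + pv B)"
    by (rule ennreal_SUP_add_left[OF ne, symmetric])
  also have "\<dots> = (SUP C\<in>?S A. SUP D\<in>?S B. ennreal (\<nu> C) + ennreal (\<nu> D))"
    by (intro SUP_cong refl ennreal_SUP_add_right[OF ne])
  also have "\<dots> \<le> pv (A \<union> B)"
    by (intro SUP_least le)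
  finally show ?thesis .
qed

private lemma pv_sum:
  assumes "range A \<subseteq> sets borel" "disjoint_family A"
  shows "(\<Sum>i<n::nat. pv (A i)) \<le> pv (\<Union>i<n. A i)"
proof (induct n)
  case 0
  then show ?case by simp
next
  case (Suc n)
  have "(\<Union>i<n. A i) \<inter> A n = {}"
    using assms(2) unfolding disjoint_family_on_def by (fastforce dest: less_imp_neq)
  then have "pv (\<Union>i<n. A i) + pv (A n) \<le> pv ((\<Union>i<n. A i) \<union> A n)"
    using assms(1) by (intro pv_superadditive) auto
  moreover have "(\<Union>i<Suc n. A i) = (\<Union>i<n. A i) \<union> A n"
    by (auto simp: less_Suc_eq)
  ultimately show ?case
    using order_trans[OF add_right_mono[OF Suc, of "pv (A n)"]] by (simp only: sum.lessThan_Suc)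
qed

text \<open>One inequality is the limit of finite superadditivity. For the other, a competitor
  \<open>B\<close> is cut along the sets \<open>A i\<close>, and \<open>\<nu> B\<close> is at most
  the sum of the positive parts of the pieces.\<close>

private lemma pv_countably_additive: "countably_additive (sets borel) pv"
proof (rule countably_additiveI)
  fix A :: "nat \<Rightarrow> 'a set"
  assume A: "range A \<subseteq> sets borel" "disjoint_family A"
  show "(\<Sum>i. pv (A i)) = pv (\<Union>i. A i)"
  proof (rule antisym)
    show "(\<Sum>i. pv (A i)) \<le> pv (\<Union>i. A i)"
      by (intro suminf_le_const summableI order_trans[OF pv_sum[OF A] pv_mono]) auto
    show "pv (\<Union>i. A i) \<le> (\<Sum>i. pv (A i))"
    proof (rule SUP_least)
      fix B assume B: "B \<in> {B \<in> sets borel. B \<subseteq> (\<Union>i. A i)}"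
      define a where "a i = \<nu> (B \<inter> A i)" for i
      have "(\<lambda>i. \<nu> (B \<inter> A i)) sums \<nu> (\<Union>i. B \<inter> A i)"
        using A B by (intro sums_disjoint) (auto simp: disjoint_family_on_def)
      moreover have "(\<Union>i. B \<inter> A i) = B"
        using B by auto
      ultimately have a: "a sums \<nu> B"
        by (simp add: a_def[abs_def])
      have le: "ennreal (max 0 (a i)) \<le> pv (A i)" for i
      proof -
        have "ennreal (a i) \<le> pv (A i)"
          unfolding a_def using A B by (intro SUP_upper) auto
        then show ?thesis
          by (cases "0 \<le> a i") (auto simp: max_def)
      qed
      show "ennreal (\<nu> B) \<le> (\<Sum>i. pv (A i))"
      \<comment> \<open>An infinite right-hand side leaves nothing to show; a finite one makes the
        positive parts summable, so the comparison can be made in the reals.\<close>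
      proof (cases "(\<Sum>i. pv (A i)) = top")
        case False
        have le2: "(\<Sum>i. ennreal (max 0 (a i))) \<le> (\<Sum>i. pv (A i))"
          by (intro suminf_le summableI le)
        then have fin: "(\<Sum>i. ennreal (max 0 (a i))) \<noteq> top"
          using False by (auto simp: top_unique)
        then have "summable (\<lambda>i. max 0 (a i))"
          by (intro summable_suminf_not_top) auto
        then have "\<nu> B \<le> (\<Sum>i. max 0 (a i))"
          using suminf_le[of a "\<lambda>i. max 0 (a i)"] a by (simp add: sums_iff)
        then have "ennreal (\<nu> B) \<le> (\<Sum>i. ennreal (max 0 (a i)))"
          using fin by (simp add: ennreal_leI)
        then show ?thesis
          using le2 by (rule order_trans)
      qed simp
    qed
  qed
qed

lemma sets_positive_variation [simp]: "sets (positive_variation \<nu>) = sets borel"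
  unfolding positive_variation_def
  using sets.sets_measure_of_eq[of "borel :: 'a measure"] by simp

lemma space_positive_variation [simp]: "space (positive_variation \<nu>) = UNIV"
  unfolding positive_variation_def by (simp add: space_measure_of_conv)

lemma emeasure_positive_variation:
  assumes "E \<in> sets borel"
  shows "emeasure (positive_variation \<nu>) E = (SUP B\<in>{B \<in> sets borel. B \<subseteq> E}. ennreal (\<nu> B))"
  unfolding positive_variation_def
proof (rule emeasure_measure_of_sigma[OF _ _ pv_countably_additive assms])
  show "sigma_algebra UNIV (sets (borel :: 'a measure))"
    using sets.sigma_algebra_axioms[of "borel :: 'a measure"] by simp
  have "{B \<in> sets borel. B \<subseteq> {}} = {{} :: 'a set}"
    by auto
  then show "positive (sets borel) pv"
    by (simp add: positive_def)
qed

lemma finite_measure_positive_variation: "finite_measure (positive_variation \<nu>)"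
proof (rule finite_measureI)
  obtain K where K: "\<And>A. A \<in> sets borel \<Longrightarrow> norm (\<nu> A) \<le> K"
    using vm_bounded by blast
  have "emeasure (positive_variation \<nu>) UNIV \<le> ennreal K"
    unfolding emeasure_positive_variation[OF borel_open[OF open_UNIV]]
  proof (rule SUP_least)
    fix A :: "'a set" assume "A \<in> {B \<in> sets borel. B \<subseteq> UNIV}"
    then show "ennreal (\<nu> A) \<le> ennreal K"
      using K[of A] by (intro ennreal_leI) auto
  qed
  then show "emeasure (positive_variation \<nu>) (space (positive_variation \<nu>)) \<noteq> \<infinity>"
    by (auto simp: top_unique)
qed

lemma le_positive_variation:
  assumes "E \<in> sets borel"
  shows "ennreal (\<nu> E) \<le> emeasure (positive_variation \<nu>) E"
  unfolding emeasure_positive_variation[OF assms]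
  using assms SUP_upper[of E "{B \<in> sets borel. B \<subseteq> E}" "\<lambda>B. ennreal (\<nu> B)"] by simp

end

section \<open>Total variation and tightness\<close>

lemma complex_measure_imp_vector_measure: "complex_measure \<mu> \<Longrightarrow> vector_measure borel \<mu>"
  by (simp add: vector_measure_def complex_measure_def)

text \<open>The modulus of \<open>\<mu> E\<close> is at most the sum of four positive variations of
  \<open>E\<close>. These are finite measures, so the sum over any partition is at most their total
  mass.\<close>

lemma total_variation_finite:
  assumes "complex_measure \<mu>"
  shows "total_variation \<mu> UNIV < top"
proof -
  have vm: "vector_measure borel (\<lambda>E. h (\<mu> E))" if "bounded_linear h" for h :: "complex \<Rightarrow> real"
    by (rule vector_measure_bounded_linear[OF complex_measure_imp_vector_measure[OF assms] that])
  define P where "P h = positive_variation (\<lambda>E. h (\<mu> E))" for h :: "complex \<Rightarrow> real"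
  let ?H = "{Re, \<lambda>z. - Re z, Im, \<lambda>z. - Im z}"
  have bl: "bounded_linear h" if "h \<in> ?H" for h
    using that by (auto intro: bounded_linear_Re bounded_linear_Im bounded_linear_minus)
  have le: "ennreal (cmod (\<mu> E)) \<le> (\<Sum>h\<in>?H. emeasure (P h) E)" if E: "E \<in> sets borel" for E
  proof -
    obtain g h where gh: "g \<in> {Re, \<lambda>z. - Re z}" "h \<in> {Im, \<lambda>z. - Im z}" "\<bar>Re (\<mu> E)\<bar> = g (\<mu> E)" "\<bar>Im (\<mu> E)\<bar> = h (\<mu> E)"
      by (metis abs_real_def insertCI)
    \<comment> \<open>Distinctness makes the sum over the set of both have two terms; at 1 the real
      part is nonzero and the imaginary part is zero.\<close>
    have ne: "g \<noteq> h"
    proof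
      assume "g = h"
      then have "g 1 = h 1" by simp
      then show False using gh(1,2) by auto
    qed
    have "ennreal (cmod (\<mu> E)) \<le> ennreal (g (\<mu> E) + h (\<mu> E))"
      using cmod_le[of "\<mu> E"] gh(3,4) by (intro ennreal_leI) simp
    also have "\<dots> = ennreal (g (\<mu> E)) + ennreal (h (\<mu> E))"
      using gh(3,4)[symmetric] by (intro ennreal_plus) auto
    also have "\<dots> \<le> emeasure (P g) E + emeasure (P h) E"
      unfolding P_def using gh(1,2) E by (intro add_mono le_positive_variation vm bl) auto
    also have "\<dots> = (\<Sum>h\<in>{g, h}. emeasure (P h) E)"
      using ne by simp
    also have "\<dots> \<le> (\<Sum>h\<in>?H. emeasure (P h) E)"
      using gh(1,2) by (intro sum_mono2) auto
    finally show ?thesis .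
  qed
  have "total_variation \<mu> UNIV \<le> (\<Sum>h\<in>?H. emeasure (P h) UNIV)"
    unfolding total_variation_def
  proof (rule SUP_least)
    fix A :: "nat \<Rightarrow> 'a set"
    assume "A \<in> {A. range A \<subseteq> sets borel \<and> disjoint_family A \<and> (\<Union>n. A n) = UNIV}"
    then have A: "range A \<subseteq> sets borel" "disjoint_family A" "(\<Union>n. A n) = UNIV"
      by auto
    have "(\<Sum>n. ennreal (cmod (\<mu> (A n)))) \<le> (\<Sum>n. \<Sum>h\<in>?H. emeasure (P h) (A n))"
      using A(1) by (intro suminf_le summableI le) auto
    also have "\<dots> = (\<Sum>h\<in>?H. \<Sum>n. emeasure (P h) (A n))"
      by (intro suminf_sum summableI)
    also have "\<dots> = (\<Sum>h\<in>?H. emeasure (P h) (\<Union>n. A n))"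
    proof (rule sum.cong[OF refl])
      fix h :: "complex \<Rightarrow> real" assume "h \<in> ?H"
      then show "(\<Sum>n. emeasure (P h) (A n)) = emeasure (P h) (\<Union>n. A n)"
        using A(1,2) by (intro suminf_emeasure) (simp_all add: P_def sets_positive_variation[OF vm[OF bl]])
    qed
    finally show "(\<Sum>n. ennreal (cmod (\<mu> (A n)))) \<le> (\<Sum>h\<in>?H. emeasure (P h) UNIV)"
      using A(3) by simp
  qed
  also have "\<dots> < top"
  proof -
    have "emeasure (P h) UNIV < top" if "h \<in> ?H" for h
      unfolding P_def
      using finite_measure.emeasure_finite[OF finite_measure_positive_variation[OF vm[OF bl[OF that]]], of UNIV]
      by (simp add: less_top)
    then show ?thesis
      by (simp only: ennreal_sum_less_top finite.intros) blast
  qed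
  finally show ?thesis .
qed

text \<open>A partition of \<open>K\<close>, preceded by \<open>B\<close> and the complement of
  both, is a partition of the whole space.\<close>

lemma total_variation_superadditive:
  assumes "B \<in> sets borel" "K \<in> sets borel" "B \<inter> K = {}"
  shows "ennreal (cmod (\<mu> B)) + total_variation \<mu> K \<le> total_variation \<mu> UNIV"
proof -
  let ?S = "\<lambda>E :: 'a set. {A :: nat \<Rightarrow> 'a set. range A \<subseteq> sets borel \<and> disjoint_family A \<and> (\<Union>n. A n) = E}"
  let ?t = "\<lambda>A. \<Sum>n. ennreal (cmod (\<mu> (A n)))"
  have "binaryset K {} \<in> ?S K"
    using assms(2) UN_binaryset_eq[of K "{}"]
    by (auto simp: range_binaryset_eq disjoint_family_on_def binaryset_def)
  then have ne: "?S K \<noteq> {}"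
    by blast
  have "ennreal (cmod (\<mu> B)) + ?t A \<le> total_variation \<mu> UNIV" if A: "A \<in> ?S K" for A
  proof -
    define A' where "A' = case_nat B (case_nat (- (B \<union> K)) A)"
    have "A' \<in> ?S UNIV"
    proof (intro CollectI conjI)
      show "range A' \<subseteq> sets borel"
        using A assms(1,2) by (auto simp: A'_def split: nat.split)
      show "disjoint_family A'"
        using A assms(3) unfolding disjoint_family_on_def A'_def
        by (auto split: nat.split)
      show "(\<Union>n. A' n) = UNIV"
      proof -
        have "A' 0 = B" "A' 1 = - (B \<union> K)" "\<And>n. A' (Suc (Suc n)) = A n"
          by (auto simp: A'_def)
        then have "B \<union> - (B \<union> K) \<union> (\<Union>n. A n) \<subseteq> (\<Union>n. A' n)"
          by (metis (no_types, lifting) UNIV_I UN_I UN_least Un_least subsetI)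
        moreover have "(\<Union>n. A n) = K"
          using A by simp
        ultimately show ?thesis
          by blast
      qed
    qed
    then have "?t A' \<le> total_variation \<mu> UNIV"
      unfolding total_variation_def by (rule SUP_upper)
    moreover have "?t A' = ?t A + (\<Sum>j<2. ennreal (cmod (\<mu> (A' j))))"
    proof -
      have "A' (n + 2) = A n" for n
        by (simp add: A'_def)
      then show ?thesis
        using suminf_offset[OF summableI, of "\<lambda>n. ennreal (cmod (\<mu> (A' n)))" 2] by (simp only:)
    qed
    moreover have "ennreal (cmod (\<mu> B)) \<le> (\<Sum>j<2. ennreal (cmod (\<mu> (A' j))))"
      by (simp add: numeral_2_eq_2 A'_def)
    ultimately have "?t A + ennreal (cmod (\<mu> B)) \<le> total_variation \<mu> UNIV"
      by (auto intro: order_trans add_left_mono)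
    then show ?thesis
      by (simp only: add.commute)
  qed
  then show ?thesis
    unfolding total_variation_def[of \<mu> K] ennreal_SUP_add_right[OF ne] by (intro SUP_least)
qed

text \<open>Inner regularity of the whole space yields a compact \<open>K\<close> missing less than
  \<open>e\<close> of the total variation; superadditivity then bounds \<open>\<mu>\<close> off
  \<open>K\<close>.\<close>

lemma regular_measure_tight:
  fixes \<mu> :: "'a::t2_space set \<Rightarrow> complex"
  assumes \<mu>: "complex_measure \<mu>" "regular_measure \<mu>" and e: "0 < e"
  obtains K where "compact K" "\<And>B. B \<in> sets borel \<Longrightarrow> B \<inter> K = {} \<Longrightarrow> cmod (\<mu> B) \<le> e"
proof -
  let ?t = "total_variation \<mu>"
  define C where "C = {K :: 'a set. compact K \<and> K \<subseteq> UNIV}"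
  have eq: "?t UNIV = (SUP K\<in>C. ?t K)"
    using \<mu>(2) unfolding regular_measure_def C_def by (metis borel_open open_UNIV)
  have ne: "C \<noteq> {}"
    by (auto simp: C_def)
  have fin: "?t UNIV \<noteq> \<infinity>"
    using total_variation_finite[OF \<mu>(1)] by simp
  obtain K where "K \<in> C" and K: "?t UNIV < ?t K + ennreal e"
    by (rule bexE[OF SUP_approx_ennreal[OF e ne eq fin]])
  then have "compact K"
    by (simp add: C_def)
  show thesis
  proof (rule that[OF \<open>compact K\<close>])
    fix B :: "'a set" assume B: "B \<in> sets borel" "B \<inter> K = {}"
    have le: "ennreal (cmod (\<mu> B)) + ?t K \<le> ?t UNIV"
      using \<open>compact K\<close> B by (intro total_variation_superadditive) (auto intro: borel_compact)
    \<comment> \<open>Finiteness permits cancelling \<open>?t K\<close> in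
      \<open>ennreal\<close>.\<close>
    then have "?t K < top"
      using total_variation_finite[OF \<mu>(1)] by (metis add.commute add_increasing2 le_less_trans order_refl zero_le)
    moreover have "?t K + ennreal (cmod (\<mu> B)) \<le> ?t K + ennreal e"
      using order_trans[OF le less_imp_le[OF K]] by (simp add: add.commute)
    ultimately have "ennreal (cmod (\<mu> B)) \<le> ennreal e"
      by (auto simp: ennreal_add_left_cancel_le)
    then show "cmod (\<mu> B) \<le> e"
      using e by (simp add: ennreal_le_iff)
  qed
qed

section \<open>Regular measures lie in the centre\<close>

lemma (in finite_measure) norm_set_integral_le:
  fixes f :: "'a \<Rightarrow> 'b::{banach, second_countable_topology}"
  assumes f: "integrable M f" and A: "A \<in> sets M" and D: "\<And>x. x \<in> A \<Longrightarrow> norm (f x) \<le> D"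
  shows "norm (LINT x:A|M. f x) \<le> D * measure M A"
proof -
  have int: "integrable M (\<lambda>x. indicator A x *\<^sub>R f x)"
    using f A by (rule integrable_mult_indicator[rotated])
  have "norm (LINT x:A|M. f x) \<le> (\<integral>x. norm (indicator A x *\<^sub>R f x) \<partial>M)"
    unfolding set_lebesgue_integral_def by (rule integral_norm_bound)
  also have "\<dots> \<le> (\<integral>x. indicator A x *\<^sub>R D \<partial>M)"
    using A by (intro integral_mono integrable_norm[OF int] integrable_mult_indicator integrable_const)
      (auto simp: indicator_def D)
  also have "\<dots> = D * measure M A"
    using A by simp
  finally show ?thesis .
qed

lemma integrable_bcontfun:
  fixes f :: "'a::topological_space \<Rightarrow>\<^sub>C complex"
  assumes "finite_measure N" "sets N = sets borel"
  shows "integrable N f"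
proof (rule finite_measure.integrable_const_bound[OF assms(1)])
  show "AE x in N. norm (f x) \<le> norm f"
    by (simp add: norm_bounded)
  have "apply_bcontfun f \<in> borel_measurable borel"
    by (intro borel_measurable_continuous_onI continuous_on_apply_bcontfun)
  then show "apply_bcontfun f \<in> borel_measurable N"
    using measurable_cong_sets[OF assms(2) refl] by blast
qed

lemma norm_integral_bcontfun_le:
  fixes f :: "'a::topological_space \<Rightarrow>\<^sub>C complex"
  assumes "finite_measure N" "sets N = sets borel"
  shows "cmod (integral\<^sup>L N f) \<le> measure N UNIV * norm f"
proof -
  interpret finite_measure N by (rule assms(1))
  have "space N = UNIV"
    using sets_eq_imp_space_eq[OF assms(2)] by simp
  then have "(LINT x:UNIV|N. f x) = integral\<^sup>L N f"
    using set_integral_space[OF integrable_bcontfun[OF assms]] by simp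
  then show ?thesis
    using norm_set_integral_le[OF integrable_bcontfun[OF assms, of f], of UNIV "norm f"] assms(2)
    by (simp add: norm_bounded mult.commute)
qed

section \<open>Riemann sums for integrals of orbit functions\<close>

context
  fixes act :: "'g::{topological_group_add, t2_space} \<Rightarrow> 'x::t2_space \<Rightarrow> 'x" and N :: "'g measure"
  assumes A: "g_space act" and fin: "finite_measure N" and sets_N: "sets N = sets borel"
begin

interpretation finite_measure N
  by (rule fin)

text \<open>The Riemann sum is built by induction on the cover: the part of \<open>E\<close> near
  \<open>t\<close> contributes its mass times \<open>ltranslate act t F\<close>, and the rest is
  covered by the remaining points. \<open>R\<close> is chosen before \<open>M\<close>, as the centre
  criterion demands.\<close>

lemma set_integral_orbit_fun_approx:
  assumes F: "F \<in> LUC act" and e: "0 < e" and "finite T" and "E \<in> sets borel"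
    and "E \<subseteq> (\<Union>t\<in>T. {s. norm (ltranslate act s F - ltranslate act t F) < e})"
  shows "\<exists>R\<in>LUC act. \<forall>M\<in>dual_space (LUC act). \<forall>C\<ge>0. (\<forall>H\<in>LUC act. cmod (M H) \<le> C * norm H) \<longrightarrow>
    cmod ((LINT s:E|N. orbit_fun act M F s) - M R) \<le> e * C * measure N E"
  using assms(3-5)
proof (induction T arbitrary: E)
  case empty
  then have "E = {}" by simp
  then show ?case
    by (intro bexI[OF _ zero_in_LUC[OF A]]) (auto simp: dual_space_zero[OF A] set_lebesgue_integral_def)
next
  case (insert t T)
  define U where "U = {s. norm (ltranslate act s F - ltranslate act t F) < e}"
  have "open U"
    unfolding U_def using F by (intro open_Collect_less continuous_intros) (simp add: LUC_def)
  then have EU: "E \<inter> U \<in> sets borel" "E - U \<in> sets borel"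
    using insert.prems(1) by auto
  have "E - U \<subseteq> (\<Union>t\<in>T. {s. norm (ltranslate act s F - ltranslate act t F) < e})"
    using insert.prems(2) by (auto simp: U_def)
  then obtain R where R: "R \<in> LUC act" and app: "\<And>M C. M \<in> dual_space (LUC act) \<Longrightarrow> 0 \<le> C \<Longrightarrow>
      (\<And>H. H \<in> LUC act \<Longrightarrow> cmod (M H) \<le> C * norm H) \<Longrightarrow>
      cmod ((LINT s:E - U|N. orbit_fun act M F s) - M R) \<le> e * C * measure N (E - U)"
    using insert.IH[OF EU(2)] by metis
  define c where "c = complex_of_real (measure N (E \<inter> U))"
  have L: "ltranslate act s F \<in> LUC act" for s
    by (rule ltranslate_in_LUC[OF A F])
  let ?R = "cscale c (ltranslate act t F) + R"
  have "cmod ((LINT s:E|N. orbit_fun act M F s) - M ?R) \<le> e * C * measure N E"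
    if M: "M \<in> dual_space (LUC act)" and C: "0 \<le> C" "\<forall>H\<in>LUC act. cmod (M H) \<le> C * norm H" for M C
  proof -
    let ?f = "\<lambda>s. orbit_fun act M F s"
    let ?v = "M (ltranslate act t F)"
    have int: "integrable N ?f"
      by (rule integrable_bcontfun[OF fin sets_N])
    have sint: "set_integrable N B ?f" if "B \<in> sets borel" for B
      unfolding set_integrable_def using that int sets_N by (intro integrable_mult_indicator) auto
    have cint: "set_integrable N B (\<lambda>s. ?v)" if "B \<in> sets borel" for B
      unfolding set_integrable_def using that sets_N by (intro integrable_mult_indicator) auto
    have "(LINT s:(E \<inter> U) \<union> (E - U)|N. ?f s) = (LINT s:E \<inter> U|N. ?f s) + (LINT s:E - U|N. ?f s)"
      using EU by (intro set_integral_Un sint) auto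
    moreover have "(E \<inter> U) \<union> (E - U) = E"
      by blast
    ultimately have split: "(LINT s:E|N. ?f s) = (LINT s:E \<inter> U|N. ?f s) + (LINT s:E - U|N. ?f s)"
      by simp
    have "measure N ((E \<inter> U) \<union> (E - U)) = measure N (E \<inter> U) + measure N (E - U)"
      using EU sets_N by (intro finite_measure_Union) auto
    then have meas: "measure N E = measure N (E \<inter> U) + measure N (E - U)"
      by (simp add: \<open>(E \<inter> U) \<union> (E - U) = E\<close>)
    \<comment> \<open>On \<open>U\<close> the integrand is \<open>M\<close> applied to a difference
      of translates of norm below \<open>e\<close>.\<close>
    have "cmod (LINT s:E \<inter> U|N. ?f s - ?v) \<le> (C * e) * measure N (E \<inter> U)"
    proof (rule norm_set_integral_le)
      show "integrable N (\<lambda>s. ?f s - ?v)"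
        using int by (intro Bochner_Integration.integrable_diff) auto
      show "E \<inter> U \<in> sets N"
        using EU sets_N by simp
      fix s assume "s \<in> E \<inter> U"
      then have s: "norm (ltranslate act s F - ltranslate act t F) < e"
        by (simp add: U_def)
      have "?f s - ?v = M (ltranslate act s F - ltranslate act t F)"
        by (simp add: apply_orbit_fun[OF A M F] dual_space_diff[OF A M L L])
      also have "cmod \<dots> \<le> C * norm (ltranslate act s F - ltranslate act t F)"
        using C(2) diff_in_LUC[OF A L L] by blast
      also have "\<dots> \<le> C * e"
        using s C(1) by (intro mult_left_mono) auto
      finally show "cmod (?f s - ?v) \<le> C * e" .
    qed
    moreover have "(LINT s:E \<inter> U|N. ?f s - ?v) = (LINT s:E \<inter> U|N. ?f s) - c * ?v"
    proof -
      have "(LINT s:E \<inter> U|N. ?v) = c * ?v"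
        using EU sets_N by (subst set_integral_const) (auto simp: c_def scaleR_conv_of_real)
      then show ?thesis
        using EU by (simp add: set_integral_diff(2) sint cint)
    qed
    ultimately have 1: "cmod ((LINT s:E \<inter> U|N. ?f s) - c * ?v) \<le> (C * e) * measure N (E \<inter> U)"
      by simp
    have 2: "cmod ((LINT s:E - U|N. ?f s) - M R) \<le> e * C * measure N (E - U)"
      using C by (intro app M) auto
    have "M ?R = c * ?v + M R"
      by (simp add: dual_space_add[OF M] dual_space_cscale[OF M] cscale_in_LUC[OF A] L R)
    then have "(LINT s:E|N. ?f s) - M ?R
      = ((LINT s:E \<inter> U|N. ?f s) - c * ?v) + ((LINT s:E - U|N. ?f s) - M R)"
      by (simp add: split)
    then have "cmod ((LINT s:E|N. ?f s) - M ?R)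
      \<le> cmod ((LINT s:E \<inter> U|N. ?f s) - c * ?v) + cmod ((LINT s:E - U|N. ?f s) - M R)"
      by (simp only: norm_triangle_ineq)
    also have "\<dots> \<le> (C * e) * measure N (E \<inter> U) + e * C * measure N (E - U)"
      by (rule add_mono[OF 1 2])
    also have "\<dots> = e * C * measure N E"
      by (simp add: meas algebra_simps)
    finally show ?thesis .
  qed
  then show ?case
    by (intro bexI[of _ ?R] ballI allI impI) (simp_all add: add_in_LUC[OF A] cscale_in_LUC[OF A] L R)
qed

text \<open>Continuity of the orbit map covers a compact \<open>K\<close> by finitely many sets of
  small oscillation, where the Riemann sum applies. Off \<open>K\<close> the mass is small and the
  integrand is at most \<open>C * norm F\<close>.\<close>

lemma integral_orbit_fun_approx:
  assumes F: "F \<in> LUC act" and e: "0 < e"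
    and tight: "\<And>d. 0 < d \<Longrightarrow> \<exists>K. compact K \<and> measure N (- K) \<le> d"
  shows "\<exists>R\<in>LUC act. \<forall>M\<in>dual_space (LUC act). \<forall>C\<ge>0. (\<forall>H\<in>LUC act. cmod (M H) \<le> C * norm H) \<longrightarrow>
    cmod (integral\<^sup>L N (orbit_fun act M F) - M R) \<le> e * C"
proof -
  \<comment> \<open>The same \<open>d\<close> bounds the oscillation on \<open>K\<close> and the
    mass off \<open>K\<close>, for a total error of at most
    \<open>C * d * (measure N UNIV + norm F)\<close>; the 1 keeps the denominator positive.\<close>
  define d where "d = e / (measure N UNIV + norm F + 1)"
  have pos: "0 < measure N UNIV + norm F + 1"
    by (intro add_nonneg_pos add_nonneg_nonneg) auto
  then have d: "0 < d"
    using e by (simp add: d_def)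
  obtain K where K: "compact K" "measure N (- K) \<le> d"
    using tight[OF d] by blast
  have KB: "K \<in> sets borel"
    by (rule borel_compact[OF K(1)])
  define U where "U t = {s. norm (ltranslate act s F - ltranslate act t F) < d}" for t
  have "open (U t)" for t
    unfolding U_def using F by (intro open_Collect_less continuous_intros) (simp add: LUC_def)
  moreover have "K \<subseteq> (\<Union>t\<in>K. U t)"
    using d by (auto simp: U_def)
  ultimately obtain T where T: "T \<subseteq> K" "finite T" "K \<subseteq> (\<Union>t\<in>T. U t)"
    using compactE_image[OF K(1), of K U] by metis
  obtain R where R: "R \<in> LUC act" and app: "\<And>M C. M \<in> dual_space (LUC act) \<Longrightarrow> 0 \<le> C \<Longrightarrow>
      (\<And>H. H \<in> LUC act \<Longrightarrow> cmod (M H) \<le> C * norm H) \<Longrightarrow>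
      cmod ((LINT s:K|N. orbit_fun act M F s) - M R) \<le> d * C * measure N K"
    using set_integral_orbit_fun_approx[OF F d T(2) KB T(3)[unfolded U_def]] by metis
  have "cmod (integral\<^sup>L N (orbit_fun act M F) - M R) \<le> e * C"
    if M: "M \<in> dual_space (LUC act)" and C: "0 \<le> C" "\<forall>H\<in>LUC act. cmod (M H) \<le> C * norm H" for M C
  proof -
    let ?f = "\<lambda>s. orbit_fun act M F s"
    have int: "integrable N ?f"
      by (rule integrable_bcontfun[OF fin sets_N])
    have sint: "set_integrable N B ?f" if "B \<in> sets borel" for B
      unfolding set_integrable_def using that int sets_N by (intro integrable_mult_indicator) auto
    have "space N = UNIV"
      using sets_eq_imp_space_eq[OF sets_N] by simp
    then have "integral\<^sup>L N ?f = (LINT s:K \<union> - K|N. ?f s)"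
      using set_integral_space[OF int] by simp
    also have "\<dots> = (LINT s:K|N. ?f s) + (LINT s:- K|N. ?f s)"
      using KB by (intro set_integral_Un sint) auto
    finally have "integral\<^sup>L N ?f - M R = ((LINT s:K|N. ?f s) - M R) + (LINT s:- K|N. ?f s)"
      by simp
    then have "cmod (integral\<^sup>L N ?f - M R) \<le> cmod ((LINT s:K|N. ?f s) - M R) + cmod (LINT s:- K|N. ?f s)"
      by (simp only: norm_triangle_ineq)
    also have "\<dots> \<le> d * C * measure N UNIV + (C * norm F) * d"
    proof (rule add_mono)
      have "measure N K \<le> measure N UNIV"
        using sets_N by (intro finite_measure_mono) auto
      then show "cmod ((LINT s:K|N. ?f s) - M R) \<le> d * C * measure N UNIV"
        using C d by (intro order_trans[OF app[OF M C(1)] mult_left_mono]) auto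
      have "cmod (LINT s:- K|N. ?f s) \<le> (C * norm F) * measure N (- K)"
      proof (rule norm_set_integral_le[OF int])
        show "- K \<in> sets N"
          using KB sets_N by auto
        show "cmod (?f s) \<le> C * norm F" for s
          using norm_bounded[of "orbit_fun act M F" s] norm_orbit_fun_le[OF A M F C(1)] C(2)
          by (meson order_trans)
      qed
      also have "\<dots> \<le> (C * norm F) * d"
        using K(2) C(1) by (intro mult_left_mono) auto
      finally show "cmod (LINT s:- K|N. ?f s) \<le> (C * norm F) * d" .
    qed
    also have "\<dots> = C * (d * (measure N UNIV + norm F))"
      by (simp add: algebra_simps)
    also have "\<dots> \<le> C * e"
    proof (rule mult_left_mono[OF _ C(1)])
      have "d * (measure N UNIV + norm F) \<le> d * (measure N UNIV + norm F + 1)"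
        using d by (intro mult_left_mono) auto
      also have "\<dots> = e"
        using pos by (simp add: d_def)
      finally show "d * (measure N UNIV + norm F) \<le> e" .
    qed
    finally show ?thesis
      by (simp only: mult.commute)
  qed
  then show ?thesis
    using R by (intro bexI[of _ R]) auto
qed

end

text \<open>The integral combines integrals against four finite positive measures. Each is
  approximated within \<open>(e / 4) * C\<close>, and the approximants are recombined with the same
  coefficients.\<close>

lemma measure_functional_in_top_centre:
  fixes act :: "'g::{topological_group_add, t2_space} \<Rightarrow> 'x::t2_space \<Rightarrow> 'x"
  assumes lc: "locally_compact_space (euclidean :: 'g topology)" and A: "g_space act"
    and \<mu>: "complex_measure \<mu>" "regular_measure \<mu>"
  shows "(\<lambda>f\<in>LUCG. complex_integral \<mu> (apply_bcontfun f)) \<in> top_centre act"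
proof -
  note G = g_space_self[OF lc]
  define N where "N h = positive_variation (\<lambda>E. h (\<mu> E))" for h :: "complex \<Rightarrow> real"
  define p :: "complex \<Rightarrow> real" where "p = (\<lambda>z. - Re z)"
  define q :: "complex \<Rightarrow> real" where "q = (\<lambda>z. - Im z)"
  let ?H = "{Re, p, Im, q}"
  have bl: "bounded_linear h" if "h \<in> ?H" for h
    using that unfolding p_def q_def by (auto intro: bounded_linear_Re bounded_linear_Im bounded_linear_minus)
  have vm: "vector_measure borel (\<lambda>E. h (\<mu> E))" if "h \<in> ?H" for h
    by (rule vector_measure_bounded_linear[OF complex_measure_imp_vector_measure[OF \<mu>(1)] bl[OF that]])
  have le_cmod: "h z \<le> cmod z" if "h \<in> ?H" for h z
    using that abs_Re_le_cmod[of z] abs_Im_le_cmod[of z] unfolding p_def q_def by auto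
  have fin: "finite_measure (N h)" and sets_N: "sets (N h) = sets borel" if "h \<in> ?H" for h
    unfolding N_def
    by (rule finite_measure_positive_variation[OF vm[OF that]], rule sets_positive_variation[OF vm[OF that]])
  \<comment> \<open>Tightness passes from \<open>\<mu>\<close> to \<open>N h\<close>: Borel sets off
    \<open>K\<close> satisfy \<open>h (\<mu> B) \<le> cmod (\<mu> B) \<le> d\<close>, which bounds
    the supremum defining the positive variation.\<close>
  have tight: "\<exists>K. compact K \<and> measure (N h) (- K) \<le> d" if h: "h \<in> ?H" and d: "0 < d" for h d
  proof -
    obtain K where K: "compact K" "\<And>B. B \<in> sets borel \<Longrightarrow> B \<inter> K = {} \<Longrightarrow> cmod (\<mu> B) \<le> d"
      using regular_measure_tight[OF \<mu> d] by blast
    have "- K \<in> sets borel"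
      using borel_compact[OF K(1)] by auto
    then have "emeasure (N h) (- K) = (SUP B\<in>{B \<in> sets borel. B \<subseteq> - K}. ennreal (h (\<mu> B)))"
      unfolding N_def by (rule emeasure_positive_variation[OF vm[OF h]])
    also have "\<dots> \<le> ennreal d"
    proof (rule SUP_least)
      fix B assume "B \<in> {B \<in> sets borel. B \<subseteq> - K}"
      then have "cmod (\<mu> B) \<le> d"
        by (intro K(2)) auto
      then show "ennreal (h (\<mu> B)) \<le> ennreal d"
        using le_cmod[OF h, of "\<mu> B"] by (intro ennreal_leI) simp
    qed
    finally have "measure (N h) (- K) \<le> d"
      using d by (simp add: measure_def enn2real_leI)
    then show ?thesis
      using K(1) by blast
  qed
  define I where "I h f = integral\<^sup>L (N h) (apply_bcontfun f)" for h and f :: "'g \<Rightarrow>\<^sub>C complex"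
  have cint: "complex_integral \<mu> (apply_bcontfun f) = (I Re f - I p f) + \<i> * (I Im f - I q f)" for f
    by (simp add: complex_integral_def I_def N_def p_def q_def)
  have I_add: "I h (f + g) = I h f + I h g" if "h \<in> ?H" for h f g
    using integrable_bcontfun[OF fin[OF that] sets_N[OF that]] by (simp add: I_def)
  have I_cscale: "I h (cscale c f) = c * I h f" for h c f
  proof -
    have "apply_bcontfun (cscale c f) = (\<lambda>x. c * f x)"
      by (rule ext) (rule apply_cscale)
    then show ?thesis
      by (simp add: I_def)
  qed
  have I_norm: "cmod (I h f) \<le> measure (N h) UNIV * norm f" if "h \<in> ?H" for h f
    unfolding I_def by (rule norm_integral_bcontfun_le[OF fin[OF that] sets_N[OF that]])
  have tri: "cmod ((a - b) + \<i> * (c - d)) \<le> cmod a + cmod b + cmod c + cmod d" for a b c d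
    using norm_triangle_ineq[of "a - b" "\<i> * (c - d)"] norm_triangle_ineq4[of a b] norm_triangle_ineq4[of c d]
    by (simp add: norm_mult)
  show ?thesis
  proof (rule top_centreI_approx[OF lc A])
    show "(\<lambda>f\<in>LUCG. complex_integral \<mu> (apply_bcontfun f)) \<in> dual_space LUCG"
    proof (rule dual_spaceI)
      fix f :: "'g \<Rightarrow>\<^sub>C complex" assume "f \<in> LUCG"
      moreover have "cmod (complex_integral \<mu> (apply_bcontfun f)) \<le> cmod (I Re f) + cmod (I p f) + cmod (I Im f) + cmod (I q f)"
        unfolding cint by (rule tri)
      moreover have "\<dots> \<le> measure (N Re) UNIV * norm f + measure (N p) UNIV * norm f
          + measure (N Im) UNIV * norm f + measure (N q) UNIV * norm f"
        by (intro add_mono I_norm) auto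
      ultimately show "cmod ((\<lambda>f\<in>LUCG. complex_integral \<mu> (apply_bcontfun f)) f)
          \<le> (measure (N Re) UNIV + measure (N p) UNIV + measure (N Im) UNIV + measure (N q) UNIV) * norm f"
        by (simp add: distrib_right)
    qed (simp_all add: add_in_LUC[OF G] cscale_in_LUC[OF G] cint I_add I_cscale algebra_simps)
  next
    fix F e assume F: "F \<in> LUC act" and e: "0 < (e::real)"
    have "\<forall>h\<in>?H. \<exists>R\<in>LUC act. \<forall>M\<in>dual_space (LUC act). \<forall>C\<ge>0. (\<forall>H\<in>LUC act. cmod (M H) \<le> C * norm H) \<longrightarrow>
        cmod (I h (orbit_fun act M F) - M R) \<le> (e / 4) * C"
      unfolding I_def using e
      by (intro ballI integral_orbit_fun_approx[OF A fin sets_N F _ tight]) auto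
    then obtain R where R: "\<And>h. h \<in> ?H \<Longrightarrow> R h \<in> LUC act"
      and app: "\<And>h M C. h \<in> ?H \<Longrightarrow> M \<in> dual_space (LUC act) \<Longrightarrow> 0 \<le> C \<Longrightarrow>
        (\<forall>H\<in>LUC act. cmod (M H) \<le> C * norm H) \<Longrightarrow> cmod (I h (orbit_fun act M F) - M (R h)) \<le> (e / 4) * C"
      by metis
    \<comment> \<open>The signs and the factor \<open>\<i>\<close> copy those of
      \<open>cint\<close>, so the four errors can be grouped.\<close>
    let ?R = "(R Re - R p) + cscale \<i> (R Im - R q)"
    have RL: "?R \<in> LUC act"
      by (intro add_in_LUC[OF A] diff_in_LUC[OF A] cscale_in_LUC[OF A] R) auto
    have "cmod ((\<lambda>f\<in>LUCG. complex_integral \<mu> (apply_bcontfun f)) (orbit_fun act M F) - M ?R) \<le> e * C"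
      if M: "M \<in> dual_space (LUC act)" and C: "0 \<le> C" "\<forall>H\<in>LUC act. cmod (M H) \<le> C * norm H" for M C
    proof -
      let ?f = "orbit_fun act M F"
      have "M ?R = (M (R Re) - M (R p)) + \<i> * (M (R Im) - M (R q))"
        by (simp add: dual_space_add[OF M] dual_space_diff[OF A M] dual_space_cscale[OF M]
          diff_in_LUC[OF A] cscale_in_LUC[OF A] R)
      then have "(\<lambda>f\<in>LUCG. complex_integral \<mu> (apply_bcontfun f)) ?f - M ?R
        = ((I Re ?f - M (R Re)) - (I p ?f - M (R p))) + \<i> * ((I Im ?f - M (R Im)) - (I q ?f - M (R q)))"
        by (simp add: orbit_fun_in_LUC[OF lc A M F] cint algebra_simps)
      then have "cmod ((\<lambda>f\<in>LUCG. complex_integral \<mu> (apply_bcontfun f)) ?f - M ?R)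
        \<le> cmod (I Re ?f - M (R Re)) + cmod (I p ?f - M (R p)) + cmod (I Im ?f - M (R Im)) + cmod (I q ?f - M (R q))"
        by (simp only: tri)
      also have "\<dots> \<le> (e / 4) * C + (e / 4) * C + (e / 4) * C + (e / 4) * C"
        by (intro add_mono app M C) auto
      also have "\<dots> = e * C"
        by simp
      finally show ?thesis .
    qed
    then show "\<exists>R\<in>LUC act. \<forall>M\<in>dual_space (LUC act). \<forall>C\<ge>0. (\<forall>H\<in>LUC act. cmod (M H) \<le> C * norm H) \<longrightarrow>
        cmod ((\<lambda>f\<in>LUCG. complex_integral \<mu> (apply_bcontfun f)) (orbit_fun act M F) - M R) \<le> e * C"
      by (intro bexI[OF _ RL]) auto
  qed
qed

theorem proposition4p6:
  fixes act :: "'g::{topological_group_add, t2_space} \<Rightarrow> 'x::t2_space \<Rightarrow> 'x"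
  assumes "locally_compact_space (euclidean :: 'g topology)"
    and "g_space act"
  shows "is_subalgebra (top_centre act)
    \<and> closedin (norm_topology (LUCG :: ('g \<Rightarrow>\<^sub>C complex) set)) (top_centre act)
    \<and> measure_algebra \<subseteq> top_centre act"
  using subalgebra_top_centre[OF assms] closedin_top_centre[OF assms]
    measure_functional_in_top_centre[OF assms]
  by (auto simp: measure_algebra_def)

end
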